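(* Let $0<\lambda<1$, let $d\ge2$ be a fixed integer, and let $K>2$ be a constant. There is a constant $c>0$ such that for every positive integer $n$, every function $f:S\to\mathbb R$ that is 1-Lipschitz with respect to the $\ell_1$ distance, every integer $t$ with $0<t\le n^K$, and every $u>0$, the supermarket jump chain $(\hat X_t)$ with $n$ queues started from the all-empty state $\mathbf 0$ satisfies $$\mathbb P_{\delta_{\mathbf 0}}\big(|f(\hat X_t)-\mathbb E_{\delta_{\mathbf 0}}[f(\hat X_t)]|\ge u\big)\le 2e^{-u^2/(4c(n+u))}+e^{-(\log n)^2/c}.$$
   Context: The supermarket jump chain with $n$ queues, arrival parameter $\lambda$ and $d$ choices is the discrete-time Markov chain $(\hat X_t)$ on $S=\{0,1,2,\dots\}^n$ (vectors of queue lengths) with the following transitions. At each step, independently of the past, the event is an arrival with probability $\lambda/(1+\lambda)$ and a potential departure with probability $1/(1+\lambda)$. If it is an arrival, a uniformly random $d$-tuple of queues is chosen (with replacement), and the length of the first shortest queue in this list is increased by 1. If it is a potential departure, one of the $n$ queues is chosen uniformly at random, and its length is decreased by 1 if it is non-empty; otherwise nothing happens. $\mathbb P_{\delta_{\mathbf 0}},\mathbb E_{\delta_{\mathbf 0}}$ refer to the chain with $\hat X_0=\mathbf 0$. $f$ is 1-Lipschitz if $|f(x)-f(y)|\le\|x-y\|_1$ for all $x,y\in S$. *)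

theory Defs
  imports "HOL-Probability.Probability"
begin

definition queue_states :: "nat \<Rightarrow> nat list set" where
  "queue_states n = {x. length x = n}"

definition l1_dist :: "nat list \<Rightarrow> nat list \<Rightarrow> real" where
  "l1_dist x y = (\<Sum>i<length x. \<bar>real (x ! i) - real (y ! i)\<bar>)"

definition lipschitz1 :: "nat \<Rightarrow> (nat list \<Rightarrow> real) \<Rightarrow> bool" where
  "lipschitz1 n f \<longleftrightarrow>
     (\<forall>x\<in>queue_states n. \<forall>y\<in>queue_states n. \<bar>f x - f y\<bar> \<le> l1_dist x y)"

definition choice_tuples :: "nat \<Rightarrow> nat \<Rightarrow> nat list set" where
  "choice_tuples n d = {js. length js = d \<and> set js \<subseteq> {..<n}}"

(* Ties in arg_min_list are resolved in favour of the earliest list element. *)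
definition arrive :: "nat list \<Rightarrow> nat list \<Rightarrow> nat list" where
  "arrive x js = (let j = arg_min_list (\<lambda>i. x ! i) js in x[j := x ! j + 1])"

(* Truncated subtraction on nat: a potential departure from an empty queue has no effect. *)
definition depart :: "nat list \<Rightarrow> nat \<Rightarrow> nat list" where
  "depart x j = x[j := x ! j - 1]"

definition jump_step :: "nat \<Rightarrow> real \<Rightarrow> nat \<Rightarrow> nat list \<Rightarrow> nat list pmf" where
  "jump_step n lam d x =
     bernoulli_pmf (lam / (1 + lam)) \<bind>
       (\<lambda>arrival. if arrival then map_pmf (arrive x) (pmf_of_set (choice_tuples n d))
                  else map_pmf (depart x) (pmf_of_set {..<n}))"

(* The law at time t of the Markov chain with transition kernel jump_step n lam d
   started from the deterministic state x0. *)
primrec jump_law :: "nat \<Rightarrow> real \<Rightarrow> nat \<Rightarrow> nat list \<Rightarrow> nat \<Rightarrow> nat list pmf" where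
  "jump_law n lam d x0 0 = return_pmf x0"
| "jump_law n lam d x0 (Suc t) = jump_law n lam d x0 t \<bind> jump_step n lam d"

definition empty_state :: "nat \<Rightarrow> nat list" where
  "empty_state n = replicate n 0"

end

(*
  The martingale is M_s = (T^(t-s) f)(X_s), with T the transition operator.  Two copies of the chain that
  differ by one extra customer can be coupled so that they stay adjacent until that customer leaves.  If the
  customer sits at level l, its level rises with probability at most (d/n) (fraction of queues of length >= l),
  which for d >= 2 is much smaller than the departure probability once l is large, as long as the sum of
  squared queue lengths is O(n).  Hence the influence of a customer at level l decays like exp(C l - a m / n)
  after m steps, and the conditional variances of M sum to O(n).  A Freedman-type estimate then gives the
  Bernstein term, and the remaining term is the probability that the sum of squares exceeds a multiple of n.
  That probability is bounded by comparison (weak majorization) with the chain that sends each arrival to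
  a uniformly random queue, whose stationary law is a product of geometric laws.
*)

theory Submission
  imports Defs "HOL-Real_Asymp.Real_Asymp"
begin

section \<open>Coupling of adjacent states\<close>

text \<open>Squares are summed because the variance budget may depend on the remaining time only and
  has to hold uniformly over uncrowded states. A customer at level l matters for at most about n * l
  steps, so with r * n steps to go only queues of length of order r count. A bound on the sum of
  squares leaves about n / r^2 of them, which is summable in r; a bound on the sum of lengths would
  leave n / r and lose a logarithm over a horizon of n powr K steps. The contraction holds only in
  uncrowded states. Visits to crowded states therefore enter additively, through their expected
  number, and states from which this number is too large are discarded as well, by Markov's
  inequality. Such losses cost powers of t, hence of n, and these are absorbed by a bound exp (-
  \<theta> * sqrt n) on the probability of being crowded at any fixed time. Everything is expressed
  by powers of the operator \<open>T\<close> on functions, where \<open>T ^^ r\<close> stands for r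
  steps to go, so that martingale arguments become backward inductions without a path space.\<close>

definition bump :: "nat list \<Rightarrow> nat \<Rightarrow> nat list" where
  "bump x j = x[j := x ! j + 1]"

lemma length_bump [simp]: "length (bump x j) = length x"
  by (simp add: bump_def)

lemma length_arrive [simp]: "length (arrive x js) = length x"
  by (simp add: arrive_def Let_def)

lemma length_depart [simp]: "length (depart x j) = length x"
  by (simp add: depart_def)

lemma arrive_eq_bump: "arrive x js = bump x (arg_min_list ((!) x) js)"
  by (simp add: arrive_def bump_def Let_def)

lemma arg_min_list_le:
  fixes f :: "'a \<Rightarrow> 'b::linorder"
  assumes "i \<in> set js"
  shows "f (arg_min_list f js) \<le> f i"
  using assms by (subst f_arg_min_list_f) auto

text \<open>Entries before the selected one stay strictly above it and later ones stay not below it,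
  so the first minimiser survives. Hence two adjacent copies pick the same queue unless the smaller
  copy picks the queue holding the extra customer.\<close>

lemma arg_min_list_raise_other:
  fixes f g :: "'a \<Rightarrow> 'b::linorder"
  assumes "js \<noteq> []" "f j \<le> g j" "\<And>i. i \<noteq> j \<Longrightarrow> g i = f i" "arg_min_list f js \<noteq> j"
  shows "arg_min_list g js = arg_min_list f js"
  using assms(1,4)
proof (induction js)
  case (Cons x js)
  show ?case
  proof (cases js)
    case js: (Cons y zs)
    let ?m = "arg_min_list f js" and ?m' = "arg_min_list g js"
    have fg: "f i \<le> g i" for i
      using assms(2,3) by (cases "i = j") auto
    have min: "f ?m \<le> f ?m'"
      by (rule arg_min_list_le, rule arg_min_list_in) (simp add: js)
    show ?thesis
    proof (cases "f x \<le> f ?m")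
      case True
      then have "x \<noteq> j" using Cons.prems js by auto
      then have "g x \<le> g ?m'"
        using True min fg[of ?m'] assms(3)[of x] by simp
      then show ?thesis using True js by simp
    next
      case False
      then have "?m \<noteq> j" using Cons.prems js by auto
      then have "?m' = ?m" "g ?m = f ?m"
        using Cons.IH js assms(3) by auto
      then show ?thesis using False js fg[of x] by (auto simp: not_le Let_def)
    qed
  qed simp
qed simp

text \<open>If the smaller copy picks \<open>j\<close>, it catches up with the larger one, and the
  customer that the larger copy adds at its own minimiser becomes the extra one. As \<open>j\<close>
  lies in the tuple, that queue is no longer than queue \<open>j\<close> with the extra customer,
  whence the level bound \<open>x ! j + 1\<close>. If it picks another queue, the copies move in
  parallel.\<close>

lemma arrive_bump:
  assumes "js \<in> choice_tuples n d" "d > 0" "length x = n" "j < n"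
  shows "\<exists>j'<n. arrive (bump x j) js = bump (arrive x js) j' \<and>
           arrive x js ! j' \<le> (if arg_min_list ((!) x) js = j then x ! j + 1 else x ! j)"
proof -
  let ?J = "arg_min_list ((!) x) js" and ?J' = "arg_min_list ((!) (bump x j)) js"
  have ne: "js \<noteq> []" and sub: "set js \<subseteq> {..<n}"
    using assms by (auto simp: choice_tuples_def)
  have J: "?J \<in> set js" "?J' \<in> set js" "?J < n" "?J' < n"
    using arg_min_list_in[OF ne] sub by auto
  have nth: "bump x j ! i = (if i = j then x ! j + 1 else x ! i)" if "i < n" for i
    using that assms by (auto simp: bump_def)
  show ?thesis
  proof (cases "?J = j")
    case False
    have "?J' = ?J"
    proof (rule arg_min_list_raise_other[OF ne _ _ False])
      fix i show "i \<noteq> j \<Longrightarrow> bump x j ! i = x ! i" by (simp add: bump_def)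
    qed (use nth assms in auto)
    then have "arrive (bump x j) js = bump (arrive x js) j"
      using False by (auto simp: arrive_eq_bump bump_def list_update_swap)
    moreover have "arrive x js ! j = x ! j"
      using False by (simp add: arrive_eq_bump bump_def)
    ultimately show ?thesis using False assms(4) by auto
  next
    case True
    have lvl: "bump x j ! ?J' \<le> bump x j ! j"
      using arg_min_list_le[of j js "(!) (bump x j)"] J True by simp
    have "arrive (bump x j) js = bump (arrive x js) ?J'"
      using True by (simp add: arrive_eq_bump)
    moreover have "arrive x js ! ?J' \<le> x ! j + 1"
      using lvl nth[of j] assms(4) True by (simp add: arrive_eq_bump)
    ultimately show ?thesis using True J by auto
  qed
qed

lemma depart_bump_other:
  assumes "k \<noteq> j"
  shows "depart (bump x j) k = bump (depart x k) j" "depart x k ! j = x ! j"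
  using assms by (auto simp: depart_def bump_def list_update_swap)

lemma depart_bump_same: "j < length x \<Longrightarrow> depart (bump x j) j = x"
  by (simp add: depart_def bump_def)

lemma bump_depart: "j < length x \<Longrightarrow> x ! j > 0 \<Longrightarrow> bump (depart x j) j = x"
  by (simp add: depart_def bump_def)

lemma depart_zero: "x ! j = 0 \<Longrightarrow> depart x j = x"
  by (metis depart_def diff_0_eq_0 list_update_id)

lemma finite_choice_tuples [simp]: "finite (choice_tuples n d)"
  using finite_lists_length_eq[of "{..<n}" d] by (simp add: choice_tuples_def conj_commute)

lemma card_choice_tuples: "card (choice_tuples n d) = n ^ d"
  using card_lists_length_eq[of "{..<n}" d] by (simp add: choice_tuples_def conj_commute)

lemma power_diff_pred_le: "h ^ d - (h - 1) ^ d \<le> d * h ^ (d - 1)" for h d :: nat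
proof (cases h)
  case 0
  then show ?thesis by (cases d) auto
next
  case (Suc m)
  have "Suc m ^ d \<le> m ^ d + d * Suc m ^ (d - 1)"
  proof (induction d)
    case (Suc d)
    have "Suc m ^ Suc d \<le> Suc m * (m ^ d + d * Suc m ^ (d - 1))"
      using mult_le_mono2[OF Suc.IH, of "Suc m"] by (simp only: power_Suc)
    also have "\<dots> = m ^ Suc d + m ^ d + d * Suc m ^ d"
      by (cases d) (auto simp: algebra_simps)
    also have "\<dots> \<le> m ^ Suc d + Suc d * Suc m ^ d"
      using power_mono[of m "Suc m" d] by simp
    finally show ?case by simp
  qed simp
  then show ?thesis using Suc by simp
qed

text \<open>Up to ties, a tuple selecting \<open>j\<close> has all entries among the h queues at
  least as long as queue \<open>j\<close> and uses \<open>j\<close> at least once. There are h^d -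
  (h-1)^d such tuples, and the discrete mean value bound keeps the factor h^(d-1), the source of the
  gain from several choices.\<close>

lemma card_arg_min_tuples_le:
  assumes "j < n" "d > 0"
  shows "card {js \<in> choice_tuples n d. arg_min_list ((!) x) js = j}
      \<le> d * card {i\<in>{..<n}. x ! j \<le> x ! i} ^ (d - 1)"
proof -
  let ?H = "{i\<in>{..<n}. x ! j \<le> x ! i}"
  let ?L = "\<lambda>A. {js. set js \<subseteq> A \<and> length js = d}"
  have "{js \<in> choice_tuples n d. arg_min_list ((!) x) js = j} \<subseteq> ?L ?H - ?L (?H - {j})"
  proof
    fix js assume js: "js \<in> {js \<in> choice_tuples n d. arg_min_list ((!) x) js = j}"
    then have "js \<noteq> []" using assms by (auto simp: choice_tuples_def)
    then have "j \<in> set js" using js arg_min_list_in by blast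
    moreover have "x ! j \<le> x ! i" if "i \<in> set js" for i
      using arg_min_list_le[OF that, of "(!) x"] js by simp
    ultimately show "js \<in> ?L ?H - ?L (?H - {j})"
      using js by (auto simp: choice_tuples_def)
  qed
  moreover have fin: "finite (?L ?H)" "finite (?L (?H - {j}))" by (simp_all add: finite_lists_length_eq)
  ultimately have "card {js \<in> choice_tuples n d. arg_min_list ((!) x) js = j}
     \<le> card (?L ?H - ?L (?H - {j}))"
    by (intro card_mono) auto
  also have "\<dots> = card (?L ?H) - card (?L (?H - {j}))"
    by (rule card_Diff_subset) (use fin in auto)
  also have "\<dots> = card ?H ^ d - (card ?H - 1) ^ d"
    using assms(1) by (simp add: card_lists_length_eq)
  finally show ?thesis using power_diff_pred_le by (rule order_trans)
qed

section \<open>The transition operator\<close>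

text \<open>Expectations are written as finite averages, so that linearity and monotonicity hold for
  all real functions without integrability conditions.\<close>

definition arrival_op :: "nat \<Rightarrow> nat \<Rightarrow> (nat list \<Rightarrow> real) \<Rightarrow> nat list \<Rightarrow> real" where
  "arrival_op n d F x = (\<Sum>js\<in>choice_tuples n d. F (arrive x js)) / real n ^ d"

definition departure_op :: "nat \<Rightarrow> (nat list \<Rightarrow> real) \<Rightarrow> nat list \<Rightarrow> real" where
  "departure_op n F x = (\<Sum>j<n. F (depart x j)) / real n"

definition step_op :: "nat \<Rightarrow> real \<Rightarrow> nat \<Rightarrow> (nat list \<Rightarrow> real) \<Rightarrow> nat list \<Rightarrow> real" where
  "step_op n lam d F x = (lam * arrival_op n d F x + departure_op n F x) / (1 + lam)"

lemma choice_tuples_nonempty: "n > 0 \<Longrightarrow> choice_tuples n d \<noteq> {}"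
  using card_choice_tuples[of n d] by fastforce

lemma expectation_jump_step:
  assumes "0 < n" "0 < lam"
  shows "measure_pmf.expectation (jump_step n lam d x) F = step_op n lam d F x"
proof -
  have p: "lam / (1 + lam) \<in> {0..1}" using assms by auto
  have ne: "choice_tuples n d \<noteq> {}" "{..<n} \<noteq> {}"
    using assms choice_tuples_nonempty by auto
  define N where "N = (\<lambda>a. if a then map_pmf (arrive x) (pmf_of_set (choice_tuples n d))
                           else map_pmf (depart x) (pmf_of_set {..<n}))"
  have fin: "finite (set_pmf (N a))" for a
    using ne by (auto simp: N_def)
  have "measure_pmf.expectation (jump_step n lam d x) F =
      (\<Sum>a\<in>UNIV. pmf (bernoulli_pmf (lam / (1 + lam))) a *\<^sub>R measure_pmf.expectation (N a) F)"
    unfolding jump_step_def N_def[symmetric]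
    by (rule pmf_expectation_bind) (use fin in auto)
  also have "\<dots> = lam / (1 + lam) * measure_pmf.expectation (N True) F
      + (1 - lam / (1 + lam)) * measure_pmf.expectation (N False) F"
    using p by (simp add: UNIV_bool)
  also have "measure_pmf.expectation (N True) F = arrival_op n d F x"
    using ne by (simp add: N_def arrival_op_def integral_pmf_of_set card_choice_tuples)
  also have "measure_pmf.expectation (N False) F = departure_op n F x"
    using ne by (simp add: N_def departure_op_def integral_pmf_of_set)
  also have "1 - lam / (1 + lam) = 1 / (1 + lam)" using assms by (simp add: field_simps)
  finally show ?thesis using assms by (simp add: step_op_def add_divide_distrib)
qed

lemma finite_set_jump_step: "0 < n \<Longrightarrow> finite (set_pmf (jump_step n lam d x))"
  using choice_tuples_nonempty[of n d] by (auto simp: jump_step_def lessThan_empty_iff)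

lemma finite_set_jump_law: "0 < n \<Longrightarrow> finite (set_pmf (jump_law n lam d x t))"
  by (induction t) (auto intro: finite_set_jump_step)

text \<open>The last step of the chain is the operator applied first, hence the induction with
  \<open>F\<close> arbitrary and the use of \<open>funpow_Suc_right\<close>. Unfolding
  \<open>T ^^ Suc r\<close> from the left, as in the later inductions, conditions on the first step
  instead.\<close>

lemma expectation_jump_law:
  assumes "0 < n" "0 < lam"
  shows "measure_pmf.expectation (jump_law n lam d x t) F = (step_op n lam d ^^ t) F x"
proof (induction t arbitrary: F)
  case (Suc t)
  have "measure_pmf.expectation (jump_law n lam d x (Suc t)) F =
    (\<Sum>y\<in>set_pmf (jump_law n lam d x t). pmf (jump_law n lam d x t) y *\<^sub>R
       measure_pmf.expectation (jump_step n lam d y) F)"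
    unfolding jump_law.simps
    by (rule pmf_expectation_bind) (use assms finite_set_jump_law finite_set_jump_step in auto)
  also have "\<dots> = measure_pmf.expectation (jump_law n lam d x t) (step_op n lam d F)"
    by (subst integral_measure_pmf[OF finite_set_jump_law[OF assms(1)]])
       (use assms in \<open>auto simp: expectation_jump_step\<close>)
  also have "\<dots> = (step_op n lam d ^^ Suc t) F x"
    by (simp only: Suc.IH funpow_Suc_right o_apply)
  finally show ?case .
qed simp

lemma prob_jump_law:
  assumes "0 < n" "0 < lam"
  shows "measure_pmf.prob (jump_law n lam d x t) A = (step_op n lam d ^^ t) (indicator A) x"
  using expectation_jump_law[OF assms, of d x t "indicator A"] by simp

section \<open>Linearity, positivity and powers of the transition operator\<close>

locale supermarket =
  fixes n :: nat and lam :: real and d :: nat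
  assumes n_pos: "0 < n" and lam_pos: "0 < lam" and d_pos: "0 < d"
begin

abbreviation T :: "(nat list \<Rightarrow> real) \<Rightarrow> nat list \<Rightarrow> real" where
  "T \<equiv> step_op n lam d"

lemma choice_head:
  assumes "js \<in> choice_tuples n d"
  shows "js \<noteq> []" "arg_min_list ((!) x) js < n" "hd js < n"
proof -
  show ne: "js \<noteq> []" using assms d_pos by (auto simp: choice_tuples_def)
  show "arg_min_list ((!) x) js < n"
    using arg_min_list_in[OF ne, of "(!) x"] assms by (auto simp: choice_tuples_def)
  show "hd js < n" using hd_in_set[OF ne] assms by (auto simp: choice_tuples_def subset_iff simp del: hd_in_set)
qed

lemma T_mono:
  assumes "\<And>y. length y = length x \<Longrightarrow> F y \<le> G y"
  shows "T F x \<le> T G x"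
  unfolding step_op_def arrival_op_def departure_op_def
  using n_pos lam_pos assms
  by (intro divide_right_mono add_mono mult_left_mono sum_mono) auto

lemma T_add: "T (\<lambda>y. F y + G y) x = T F x + T G x"
  using lam_pos by (simp add: step_op_def arrival_op_def departure_op_def sum.distrib field_simps
      flip: add_divide_distrib)

lemma T_cmult: "T (\<lambda>y. c * F y) x = c * T F x"
  using lam_pos by (simp add: step_op_def arrival_op_def departure_op_def field_simps
      flip: sum_distrib_left)

lemma T_const: "T (\<lambda>y. c) x = c"
  using lam_pos n_pos
  by (simp add: step_op_def arrival_op_def departure_op_def card_choice_tuples divide_simps)
     (simp add: algebra_simps)

lemma T_sum: "T (\<lambda>y. \<Sum>i\<in>I. F i y) x = (\<Sum>i\<in>I. T (F i) x)"
proof (cases "finite I")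
  case True
  then show ?thesis by induction (simp_all add: T_const T_add)
qed (simp add: T_const)

lemma T_uminus: "T (\<lambda>y. - F y) x = - T F x"
  using T_cmult[of "-1"] by simp

lemma T_diff: "T (\<lambda>y. F y - G y) x = T F x - T G x"
  using T_add[of F "\<lambda>y. - G y"] by (simp add: T_uminus)

lemma Tpow_uminus: "(T ^^ t) (\<lambda>y. - F y) x = - (T ^^ t) F x"
proof (induction t arbitrary: x)
  case (Suc t)
  then have "(T ^^ t) (\<lambda>y. - F y) = (\<lambda>y. - (T ^^ t) F y)" by auto
  then show ?case by (simp add: T_uminus)
qed simp

lemma Tpow_mono:
  assumes "\<And>y. length y = length x \<Longrightarrow> F y \<le> G y"
  shows "(T ^^ t) F x \<le> (T ^^ t) G x"
  using assms
proof (induction t arbitrary: x)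
  case (Suc t)
  then show ?case by (auto intro!: T_mono)
qed simp

lemma Tpow_cmult: "(T ^^ t) (\<lambda>y. c * F y) = (\<lambda>x. c * (T ^^ t) F x)"
  by (induction t) (auto simp: T_cmult)

lemma Tpow_const: "(T ^^ t) (\<lambda>y. c) = (\<lambda>x. c)"
  by (induction t) (auto simp: T_const)

lemma Tpow_nonneg: "(\<And>y. F y \<ge> 0) \<Longrightarrow> (T ^^ t) F x \<ge> 0"
  using Tpow_mono[of x "\<lambda>_. 0" F t] by (simp add: Tpow_const)

lemma Tpow_sum: "(T ^^ t) (\<lambda>y. \<Sum>i\<in>I. F i y) = (\<lambda>x. \<Sum>i\<in>I. (T ^^ t) (F i) x)"
  by (induction t) (auto simp: T_sum)

lemma Tpow_add: "(T ^^ t) (\<lambda>y. F y + G y) = (\<lambda>x. (T ^^ t) F x + (T ^^ t) G x)"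
  by (induction t) (auto simp: T_add)

end

section \<open>Choice probabilities and one-step estimates for an adjacent pair\<close>

context supermarket
begin

definition choice_prob :: "nat list \<Rightarrow> nat \<Rightarrow> real" where
  "choice_prob x j =
     real (card {js \<in> choice_tuples n d. arg_min_list ((!) x) js = j}) / real n ^ d"

lemma choice_prob_nonneg: "0 \<le> choice_prob x j"
  by (simp add: choice_prob_def)

lemma choice_prob_le_tail:
  assumes "j < n"
  shows "choice_prob x j \<le> real d / real n * (real (card {i\<in>{..<n}. x ! j \<le> x ! i}) / real n) ^ (d - 1)"
proof -
  let ?h = "card {i\<in>{..<n}. x ! j \<le> x ! i}"
  have "choice_prob x j \<le> real (d * ?h ^ (d - 1)) / real n ^ d"
    unfolding choice_prob_def using n_pos card_arg_min_tuples_le[OF assms d_pos, of x]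
    by (intro divide_right_mono) (auto simp flip: of_nat_power of_nat_mult)
  also have "real n ^ d = real n * real n ^ (d - 1)"
    using d_pos by (cases d) auto
  finally show ?thesis by (simp add: power_divide)
qed

lemma choice_prob_le: "j < n \<Longrightarrow> choice_prob x j \<le> real d / real n"
proof -
  assume j: "j < n"
  have "card {i\<in>{..<n}. x ! j \<le> x ! i} \<le> card {..<n}" by (rule card_mono) auto
  then have "(real (card {i\<in>{..<n}. x ! j \<le> x ! i}) / real n) ^ (d - 1) \<le> 1"
    using n_pos by (intro power_le_one) (auto simp: divide_simps)
  then have "real d / real n * (real (card {i\<in>{..<n}. x ! j \<le> x ! i}) / real n) ^ (d - 1)
       \<le> real d / real n * 1" by (intro mult_left_mono) auto
  then show ?thesis using choice_prob_le_tail[OF j, of x] by simp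
qed

lemma arrival_op_eq_sum: "arrival_op n d F x = (\<Sum>j<n. choice_prob x j * F (bump x j))"
proof -
  let ?J = "\<lambda>js. arg_min_list ((!) x) js"
  have "(\<Sum>js\<in>choice_tuples n d. F (arrive x js)) =
      (\<Sum>j<n. \<Sum>js\<in>{js \<in> choice_tuples n d. ?J js = j}. F (bump x (?J js)))"
    unfolding arrive_eq_bump
    by (rule sum.group[symmetric]) (auto simp: choice_head)
  also have "\<dots> = (\<Sum>j<n. real (card {js \<in> choice_tuples n d. ?J js = j}) * F (bump x j))"
    by (intro sum.cong) auto
  finally show ?thesis
    by (simp add: arrival_op_def choice_prob_def sum_divide_distrib)
qed

lemma arrival_avg_const: "(\<Sum>js\<in>choice_tuples n d. c) / real n ^ d = c"
  using n_pos by (simp add: card_choice_tuples)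

text \<open>
  The natural coupling of two copies that differ by one extra customer: the pair stays adjacent or
  coalesces, and the level of the extra customer goes up only if its queue is the one chosen.
\<close>

lemma arrival_op_bump_diff:
  assumes x: "length x = n" and j: "j < n" and "mono \<phi>"
    and D: "\<And>z i. length z = n \<Longrightarrow> i < n \<Longrightarrow> \<bar>g (bump z i) - g z\<bar> \<le> \<phi> (z ! i) + s z"
  shows "\<bar>arrival_op n d g (bump x j) - arrival_op n d g x\<bar>
    \<le> \<phi> (x ! j) + choice_prob x j * (\<phi> (x ! j + 1) - \<phi> (x ! j)) + arrival_op n d s x"
proof -
  let ?C = "choice_tuples n d" and ?J = "\<lambda>js. arg_min_list ((!) x) js"
  let ?e = "\<lambda>js. if ?J js = j then \<phi> (x ! j + 1) - \<phi> (x ! j) else 0"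
  have nd: "real n ^ d > 0" using n_pos by simp
  have "\<bar>g (arrive (bump x j) js) - g (arrive x js)\<bar> \<le> \<phi> (x ! j) + ?e js + s (arrive x js)"
    if js: "js \<in> ?C" for js
  proof -
    obtain i where i: "i < n" "arrive (bump x j) js = bump (arrive x js) i"
      "arrive x js ! i \<le> (if ?J js = j then x ! j + 1 else x ! j)"
      using arrive_bump[OF js d_pos x j] by blast
    have "\<bar>g (bump (arrive x js) i) - g (arrive x js)\<bar> \<le> \<phi> (arrive x js ! i) + s (arrive x js)"
      by (rule D) (use x i in auto)
    also have "\<phi> (arrive x js ! i) \<le> \<phi> (x ! j) + ?e js"
      using monoD[OF \<open>mono \<phi>\<close> i(3)] by (auto split: if_splits)
    finally show ?thesis using i by simp
  qed
  then have "\<bar>\<Sum>js\<in>?C. g (arrive (bump x j) js) - g (arrive x js)\<bar>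
      \<le> (\<Sum>js\<in>?C. \<phi> (x ! j) + ?e js + s (arrive x js))"
    by (rule order_trans[OF sum_abs sum_mono])
  moreover have "(\<Sum>js\<in>?C. ?e js) =
      real (card {js \<in> ?C. ?J js = j}) * (\<phi> (x ! j + 1) - \<phi> (x ! j))"
    by (simp add: sum.If_cases Int_def)
  ultimately have "\<bar>\<Sum>js\<in>?C. g (arrive (bump x j) js) - g (arrive x js)\<bar> / real n ^ d
     \<le> ((\<Sum>js\<in>?C. \<phi> (x ! j)) + real (card {js \<in> ?C. ?J js = j}) * (\<phi> (x ! j + 1) - \<phi> (x ! j))
         + (\<Sum>js\<in>?C. s (arrive x js))) / real n ^ d"
    by (intro divide_right_mono) (auto simp: sum.distrib)
  also have "\<dots> = \<phi> (x ! j) + choice_prob x j * (\<phi> (x ! j + 1) - \<phi> (x ! j)) + arrival_op n d s x"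
    unfolding add_divide_distrib arrival_avg_const
    by (simp add: choice_prob_def arrival_op_def)
  also have "\<bar>\<Sum>js\<in>?C. g (arrive (bump x j) js) - g (arrive x js)\<bar> / real n ^ d
      = \<bar>arrival_op n d g (bump x j) - arrival_op n d g x\<bar>"
    using nd by (simp add: arrival_op_def sum_subtractf abs_divide flip: diff_divide_distrib)
  finally show ?thesis .
qed

text \<open>A departure at another queue leaves the pair adjacent at the same level. A departure at
  \<open>j\<close> lowers the extra customer by one level, except when \<open>x ! j = 0\<close>:
  then only the larger copy loses a customer and the copies coalesce, which is why the weight below
  level 0 is 0.\<close>

lemma departure_op_bump_diff:
  assumes x: "length x = n" and j: "j < n" and s: "\<And>z. s z \<ge> 0"
    and D: "\<And>z i. length z = n \<Longrightarrow> i < n \<Longrightarrow> \<bar>g (bump z i) - g z\<bar> \<le> \<phi> (z ! i) + s z"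
  shows "\<bar>departure_op n g (bump x j) - departure_op n g x\<bar>
    \<le> \<phi> (x ! j) - (\<phi> (x ! j) - (if x ! j = 0 then 0 else \<phi> (x ! j - 1))) / real n + departure_op n s x"
proof -
  let ?p = "if x ! j = 0 then 0 else \<phi> (x ! j - 1)"
  have "\<bar>g (depart (bump x j) k) - g (depart x k)\<bar>
      \<le> \<phi> (x ! j) - (if k = j then \<phi> (x ! j) - ?p else 0) + s (depart x k)" if k: "k < n" for k
  proof (cases "k = j")
    case False
    then show ?thesis using D[of "depart x k" j] x j depart_bump_other[OF False, of x] by simp
  next
    case True
    show ?thesis
    proof (cases "x ! j = 0")
      case 0: True
      then show ?thesis using True x j s by (simp add: depart_bump_same depart_zero)
    next
      case False
      then have "depart x j ! j = x ! j - 1" using x j by (simp add: depart_def)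
      then show ?thesis
        using D[of "depart x j" j] True False x j by (simp add: depart_bump_same bump_depart)
    qed
  qed
  then have "\<bar>\<Sum>k<n. g (depart (bump x j) k) - g (depart x k)\<bar>
      \<le> (\<Sum>k<n. \<phi> (x ! j) - (if k = j then \<phi> (x ! j) - ?p else 0) + s (depart x k))"
    by (intro order_trans[OF sum_abs sum_mono]) auto
  also have "\<dots> = real n * \<phi> (x ! j) - (\<phi> (x ! j) - ?p) + (\<Sum>k<n. s (depart x k))"
    using j by (simp add: sum.distrib sum_subtractf)
  finally have "\<bar>\<Sum>k<n. g (depart (bump x j) k) - g (depart x k)\<bar> / real n
      \<le> (real n * \<phi> (x ! j) - (\<phi> (x ! j) - ?p) + (\<Sum>k<n. s (depart x k))) / real n"
    by (rule divide_right_mono) simp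
  moreover have "\<bar>\<Sum>k<n. g (depart (bump x j) k) - g (depart x k)\<bar> / real n
      = \<bar>departure_op n g (bump x j) - departure_op n g x\<bar>"
    by (simp add: departure_op_def sum_subtractf abs_divide flip: diff_divide_distrib)
  moreover have "(real n * \<phi> (x ! j) - (\<phi> (x ! j) - ?p) + (\<Sum>k<n. s (depart x k))) / real n
      = \<phi> (x ! j) - (\<phi> (x ! j) - ?p) / real n + departure_op n s x"
    using n_pos unfolding departure_op_def by (simp add: add_divide_distrib diff_divide_distrib)
  ultimately show ?thesis by simp
qed

text \<open>The middle term is the drift of \<phi> along the level of the extra customer: a
  birth-and-death chain killed below level 0, whose upward rate depends on the state. The error
  \<open>s\<close>, common to all customers, is merely transported by \<open>T\<close>.\<close>

lemma T_bump_diff: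
  assumes x: "length x = n" and j: "j < n" and "mono \<phi>" and s: "\<And>z. s z \<ge> 0"
    and D: "\<And>z i. length z = n \<Longrightarrow> i < n \<Longrightarrow> \<bar>g (bump z i) - g z\<bar> \<le> \<phi> (z ! i) + s z"
  shows "\<bar>T g (bump x j) - T g x\<bar>
    \<le> \<phi> (x ! j) + (lam * choice_prob x j * (\<phi> (x ! j + 1) - \<phi> (x ! j))
        - (\<phi> (x ! j) - (if x ! j = 0 then 0 else \<phi> (x ! j - 1))) / real n) / (1 + lam) + T s x"
proof -
  define a b c e where "a = arrival_op n d g (bump x j) - arrival_op n d g x"
    and "b = departure_op n g (bump x j) - departure_op n g x"
    and "c = choice_prob x j * (\<phi> (x ! j + 1) - \<phi> (x ! j))"
    and "e = (\<phi> (x ! j) - (if x ! j = 0 then 0 else \<phi> (x ! j - 1))) / real n"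
  have "\<bar>a\<bar> \<le> \<phi> (x ! j) + c + arrival_op n d s x"
    unfolding a_def c_def by (rule arrival_op_bump_diff[where \<phi>=\<phi> and s=s and g=g, OF x j \<open>mono \<phi>\<close> D])
  moreover have "\<bar>b\<bar> \<le> \<phi> (x ! j) - e + departure_op n s x"
    unfolding b_def e_def by (rule departure_op_bump_diff[where \<phi>=\<phi> and s=s and g=g, OF x j s D])
  moreover have "\<bar>lam * a + b\<bar> \<le> lam * \<bar>a\<bar> + \<bar>b\<bar>"
    using lam_pos abs_triangle_ineq[of "lam * a" b] by (simp add: abs_mult)
  moreover have "lam * \<bar>a\<bar> + \<bar>b\<bar>
      \<le> lam * (\<phi> (x ! j) + c + arrival_op n d s x) + (\<phi> (x ! j) - e + departure_op n s x)"
    using lam_pos calculation(1,2) by (intro add_mono mult_left_mono) auto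
  ultimately have "\<bar>lam * a + b\<bar>
      \<le> lam * (\<phi> (x ! j) + c + arrival_op n d s x) + (\<phi> (x ! j) - e + departure_op n s x)"
    by linarith
  then have "\<bar>lam * a + b\<bar> / (1 + lam)
      \<le> (lam * (\<phi> (x ! j) + c + arrival_op n d s x) + (\<phi> (x ! j) - e + departure_op n s x)) / (1 + lam)"
    using lam_pos by (intro divide_right_mono) auto
  moreover have "T g (bump x j) - T g x = (lam * a + b) / (1 + lam)"
    unfolding a_def b_def step_op_def diff_divide_distrib[symmetric] by (simp add: algebra_simps)
  then have "\<bar>lam * a + b\<bar> / (1 + lam) = \<bar>T g (bump x j) - T g x\<bar>"
    using lam_pos by (simp add: abs_divide)
  moreover have "(lam * (\<phi> (x ! j) + c + arrival_op n d s x) + (\<phi> (x ! j) - e + departure_op n s x)) / (1 + lam)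
    = \<phi> (x ! j) + (lam * c - e) / (1 + lam) + T s x"
    using lam_pos by (simp add: step_op_def divide_simps) (simp add: algebra_simps)
  ultimately show ?thesis unfolding c_def e_def by (simp add: mult.assoc)
qed

section \<open>Classes of functions preserved by the coupling\<close>

definition bump_lipschitz :: "(nat list \<Rightarrow> real) \<Rightarrow> bool" where
  "bump_lipschitz g \<longleftrightarrow> (\<forall>x j. length x = n \<longrightarrow> j < n \<longrightarrow> \<bar>g (bump x j) - g x\<bar> \<le> 1)"

definition increasing :: "(nat list \<Rightarrow> real) \<Rightarrow> bool" where
  "increasing g \<longleftrightarrow> (\<forall>x j. length x = n \<longrightarrow> j < n \<longrightarrow> g x \<le> g (bump x j))"

text \<open>The constant weight 1 has nonpositive drift: a coupled pair never moves further
  apart.\<close>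

lemma bump_lipschitz_T:
  assumes "bump_lipschitz g"
  shows "bump_lipschitz (T g)"
  unfolding bump_lipschitz_def
proof (intro allI impI)
  fix x :: "nat list" and j assume x: "length x = n" "j < n"
  have "\<bar>T g (bump x j) - T g x\<bar> \<le> 1 + (lam * choice_prob x j * (1 - 1)
        - (1 - (if x ! j = 0 then 0 else 1)) / real n) / (1 + lam) + T (\<lambda>_. 0) x"
    using T_bump_diff[where \<phi>="\<lambda>_. 1" and s="\<lambda>_. 0" and g=g, OF x] assms by (simp add: bump_lipschitz_def monoI)
  also have "\<dots> \<le> 1" using lam_pos n_pos by (simp add: T_const)
  finally show "\<bar>T g (bump x j) - T g x\<bar> \<le> 1" .
qed

lemma bump_lipschitz_Tpow: "bump_lipschitz g \<Longrightarrow> bump_lipschitz ((T ^^ t) g)"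
  by (induction t) (auto intro: bump_lipschitz_T)

text \<open>The coupling respects the order of the two copies. Monotonicity is wanted for
  \<open>crowding\<close>, whose value after a departure has to be bounded by its value at the
  current state.\<close>

lemma increasing_T:
  assumes g: "increasing g"
  shows "increasing (T g)"
  unfolding increasing_def
proof (intro allI impI)
  fix x :: "nat list" and j assume x: "length x = n" and j: "j < n"
  have "g (arrive x js) \<le> g (arrive (bump x j) js)" if "js \<in> choice_tuples n d" for js
    using arrive_bump[OF that d_pos x j] g x by (auto simp: increasing_def)
  moreover have "g (depart x k) \<le> g (depart (bump x j) k)" if "k < n" for k
  proof (cases "k = j")
    case False
    then show ?thesis using g x j by (simp add: increasing_def depart_bump_other)
  next
    case True
    then have dep: "depart (bump x j) k = x" using x j by (simp add: depart_bump_same)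
    show ?thesis
    proof (cases "x ! j = 0")
      case True
      with \<open>k = j\<close> dep show ?thesis by (simp add: depart_zero)
    next
      case False
      have "g (depart x j) \<le> g (bump (depart x j) j)"
        using g x j by (simp add: increasing_def)
      with \<open>k = j\<close> dep False x j show ?thesis by (simp add: bump_depart)
    qed
  qed
  ultimately show "T g x \<le> T g (bump x j)"
    unfolding step_op_def arrival_op_def departure_op_def using lam_pos n_pos
    by (intro divide_right_mono add_mono mult_left_mono sum_mono) auto
qed

lemma increasing_Tpow: "increasing g \<Longrightarrow> increasing ((T ^^ t) g)"
  by (induction t) (auto intro: increasing_T)

end

section \<open>Decay of the influence of one customer\<close>

definition sumsq :: "nat list \<Rightarrow> real" where
  "sumsq x = (\<Sum>i<length x. (real (x ! i))\<^sup>2)"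

lemma l1_dist_bump: "j < length x \<Longrightarrow> l1_dist (bump x j) x = 1"
proof -
  assume j: "j < length x"
  have "l1_dist (bump x j) x = (\<Sum>i<length x. if i = j then 1 else 0)"
    unfolding l1_dist_def by (intro sum.cong) (auto simp: bump_def nth_list_update)
  then show ?thesis using j by simp
qed

text \<open>Increments of a Lyapunov weight for the level of the extra customer, used with
  \<open>A = real d\<close>. Below level \<open>k\<close> a rise may be up to \<open>A\<close> times
  as likely as a departure, so the increments shrink by the factor 1 / (2 * A). From
  \<open>k\<close> on a rise has probability at most 1 / (4 * n), so they may double. In both
  regimes the expected gain is at most half of the expected loss, and doubling keeps the increment
  comparable with the total weight.\<close>

definition level_incr :: "real \<Rightarrow> nat \<Rightarrow> nat \<Rightarrow> real" where
  "level_incr A k i = (1 / (2 * A)) ^ min i k * 2 ^ (i - k)"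

definition level_weight :: "real \<Rightarrow> nat \<Rightarrow> nat \<Rightarrow> real" where
  "level_weight A k l = (\<Sum>i\<le>l. level_incr A k i)"

lemma level_weight_Suc: "level_weight A k (Suc l) = level_weight A k l + level_incr A k (Suc l)"
  by (simp add: level_weight_def)

lemma level_incr_pos: "A > 0 \<Longrightarrow> level_incr A k i > 0"
  by (simp add: level_incr_def)

lemma level_incr_Suc_low: "A > 0 \<Longrightarrow> i < k \<Longrightarrow> A * level_incr A k (Suc i) = level_incr A k i / 2"
  by (simp add: level_incr_def min_def)

lemma level_incr_Suc_high: "k \<le> i \<Longrightarrow> level_incr A k (Suc i) = 2 * level_incr A k i"
  by (cases "i = k") (auto simp: level_incr_def min_def Suc_diff_le)

lemma level_incr_le: "A \<ge> 1 \<Longrightarrow> level_incr A k i \<le> 2 ^ i"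
proof -
  assume A: "A \<ge> 1"
  have "(1 / (2 * A)) ^ min i k * 2 ^ (i - k) \<le> 1 * (2::real) ^ i"
    using A by (intro mult_mono power_le_one power_increasing) auto
  then show ?thesis by (simp add: level_incr_def)
qed

lemma level_weight_mono: "A > 0 \<Longrightarrow> mono (level_weight A k)"
  using level_incr_pos by (intro incseq_SucI) (simp add: level_weight_Suc less_imp_le)

lemma level_weight_ge_1: "A > 0 \<Longrightarrow> level_weight A k l \<ge> 1"
  using monoD[OF level_weight_mono, of A 0 l k] by (simp add: level_weight_def level_incr_def)

lemma level_weight_le: "A \<ge> 1 \<Longrightarrow> level_weight A k l \<le> 2 * 2 ^ l"
proof (induction l)
  case 0
  then show ?case by (simp add: level_weight_def level_incr_def)
next
  case (Suc l)
  then show ?case using level_incr_le[of A k "Suc l"] by (simp add: level_weight_Suc)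
qed

text \<open>It turns a drift proportional to the last increment into exponential decay of the whole
  weight. Up to level \<open>k\<close> there are at most k + 1 increments, each at most 1 and at
  least (1 / (2 * A))^k. Beyond \<open>k\<close> the increments double, and the summand 2 in the
  constant H gives H / 2 + 1 \<le> H, which closes the induction.\<close>

lemma level_weight_le_incr:
  assumes A: "A \<ge> 1"
  shows "level_weight A k l \<le> ((real k + 1) * (2 * A) ^ k + 2) * level_incr A k l"
proof -
  define H where "H = (real k + 1) * (2 * A) ^ k + 2"
  have low: "level_weight A k l \<le> H * level_incr A k l" if "l \<le> k" for l
  proof -
    have "level_weight A k l \<le> (\<Sum>i\<le>l. 1)"
      unfolding level_weight_def using that A
      by (intro sum_mono) (auto simp: level_incr_def intro!: power_le_one)
    also have "\<dots> \<le> real k + 1" using that by simp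
    also have "\<dots> = (real k + 1) * (2 * A) ^ k * (1 / (2 * A)) ^ k"
      using A by (simp add: power_divide)
    also have "\<dots> \<le> H * (1 / (2 * A)) ^ l"
    proof (rule mult_mono)
      show "(1 / (2 * A)) ^ k \<le> (1 / (2 * A)) ^ l"
        using A that by (intro power_decreasing) auto
    qed (use A in \<open>auto simp: H_def\<close>)
    also have "\<dots> = H * level_incr A k l" using that by (simp add: level_incr_def)
    finally show ?thesis .
  qed
  have H: "H \<ge> 2" using A by (simp add: H_def)
  have "level_weight A k l \<le> H * level_incr A k l"
  proof (cases "l \<le> k")
    case False
    then have "k \<le> l" by simp
    then show ?thesis
    proof (induction l rule: dec_induct)
      case (step l)
      have "level_weight A k (Suc l) \<le> H * level_incr A k l + level_incr A k (Suc l)"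
        using step by (simp add: level_weight_Suc)
      also have "\<dots> = (H / 2 + 1) * level_incr A k (Suc l)"
        using step by (simp add: level_incr_Suc_high field_simps)
      also have "\<dots> \<le> H * level_incr A k (Suc l)"
        using H A level_incr_pos[of A k "Suc l"] by (intro mult_right_mono) auto
      finally show ?case .
    qed (use low in simp)
  qed (use low in simp)
  then show ?thesis by (simp add: H_def)
qed

text \<open>This trades an exponential in the level for the second power, which \<open>sumsq\<close>
  controls; \<open>r\<close> is time in units of n steps. If \<alpha> * r < 2 * (1 + l), then 1 + r
  is at most a multiple of 1 + l and the right side is at least 1. Otherwise half of the exponent
  absorbs 2 * 2^l, and the other half beats the square.\<close>

lemma exponential_weight_le_polynomial:
  fixes \<alpha> r :: real and l :: nat
  assumes "\<alpha> > 0" "r \<ge> 0"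
  shows "min 1 (exp (- \<alpha> * r) * (2 * 2 ^ l)) \<le> (1 + 4 / \<alpha>)\<^sup>2 * (1 + real l)\<^sup>2 / (1 + r)\<^sup>2"
proof (cases "\<alpha> * r \<ge> 2 * (1 + real l)")
  case False
  have "r < (2 / \<alpha>) * (1 + real l)"
    using False assms by (simp add: field_simps)
  then have "1 + r \<le> (1 + 4 / \<alpha>) * (1 + real l)"
  proof -
    have "2 / \<alpha> * (1 + real l) \<le> 4 / \<alpha> * (1 + real l)"
      using assms by (intro mult_right_mono divide_right_mono) auto
    then show ?thesis using \<open>r < _\<close> by (simp add: distrib_right)
  qed
  then have "(1 + r)\<^sup>2 \<le> ((1 + 4 / \<alpha>) * (1 + real l))\<^sup>2"
    using assms by (intro power_mono) auto
  then have "1 \<le> (1 + 4 / \<alpha>)\<^sup>2 * (1 + real l)\<^sup>2 / (1 + r)\<^sup>2"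
    using assms by (simp add: power_mult_distrib)
  then show ?thesis by linarith
next
  case True
  have "2 * 2 ^ l = (2::real) ^ Suc l" by simp
  also have "\<dots> \<le> exp 1 ^ Suc l" using exp_ge_add_one_self[of 1] by (intro power_mono) auto
  also have "\<dots> = exp (1 + real l)" by (simp add: exp_add flip: exp_of_nat_mult)
  also have "\<dots> \<le> exp (\<alpha> * r / 2)" using True by simp
  finally have "exp (- \<alpha> * r) * (2 * 2 ^ l) \<le> exp (- \<alpha> * r) * exp (\<alpha> * r / 2)" by simp
  also have "\<dots> = exp (- (\<alpha> * r / 2))" by (simp flip: exp_add)
  finally have 1: "exp (- \<alpha> * r) * (2 * 2 ^ l) \<le> exp (- (\<alpha> * r / 2))" .
  have "1 + r \<le> (1 + 4 / \<alpha>) * (1 + \<alpha> * r / 4)"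
    using assms by (simp add: field_simps)
  also have "\<dots> \<le> (1 + 4 / \<alpha>) * exp (\<alpha> * r / 4)"
    using assms by (intro mult_left_mono exp_ge_add_one_self) auto
  finally have "(1 + r)\<^sup>2 \<le> ((1 + 4 / \<alpha>) * exp (\<alpha> * r / 4))\<^sup>2"
    using assms by (intro power_mono) auto
  also have "\<dots> = (1 + 4 / \<alpha>)\<^sup>2 * exp (\<alpha> * r / 2)"
    by (simp add: power_mult_distrib flip: exp_double)
  finally have "exp (- (\<alpha> * r / 2)) * (1 + r)\<^sup>2 \<le> (1 + 4 / \<alpha>)\<^sup>2 * (exp (\<alpha> * r / 2) * exp (- (\<alpha> * r / 2)))"
    by (simp add: exp_minus field_simps)
  then have "exp (- (\<alpha> * r / 2)) * (1 + r)\<^sup>2 \<le> (1 + 4 / \<alpha>)\<^sup>2"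
    by (simp flip: exp_add)
  also have "\<dots> \<le> (1 + 4 / \<alpha>)\<^sup>2 * (1 + real l)\<^sup>2"
    using mult_left_mono[of 1 "(1 + real l)\<^sup>2" "(1 + 4 / \<alpha>)\<^sup>2"] one_le_power[of "1 + real l" 2] by simp
  finally have "exp (- (\<alpha> * r / 2)) \<le> (1 + 4 / \<alpha>)\<^sup>2 * (1 + real l)\<^sup>2 / (1 + r)\<^sup>2"
    using assms by (simp add: pos_le_divide_eq)
  with 1 show ?thesis by linarith
qed

lemma card_level_le:
  assumes "sumsq x \<le> B" "length x = n" "l > 0"
  shows "real (card {i\<in>{..<n}. l \<le> x ! i}) \<le> B / (real l)\<^sup>2"
proof -
  have "real (card {i\<in>{..<n}. l \<le> x ! i}) * (real l)\<^sup>2 = (\<Sum>i\<in>{i\<in>{..<n}. l \<le> x ! i}. (real l)\<^sup>2)"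
    by simp
  also have "\<dots> \<le> (\<Sum>i\<in>{i\<in>{..<n}. l \<le> x ! i}. (real (x ! i))\<^sup>2)"
    by (intro sum_mono power_mono) auto
  also have "\<dots> \<le> sumsq x" unfolding sumsq_def using assms(2) by (intro sum_mono2) auto
  finally show ?thesis using assms by (simp add: pos_le_divide_eq)
qed

context supermarket
begin

lemma lipschitz1_imp_bump_lipschitz: "lipschitz1 n f \<Longrightarrow> bump_lipschitz f"
  unfolding lipschitz1_def bump_lipschitz_def queue_states_def
  by (metis (mono_tags, lifting) l1_dist_bump length_bump mem_Collect_eq)

definition crowded :: "real \<Rightarrow> nat list set" where
  "crowded C = {x. sumsq x > C * real n}"

text \<open>The expected number of visits to \<open>crowded C\<close> at the times 0, ..., m - 1 for
  the chain started from \<open>x\<close>.\<close>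

definition crowding :: "real \<Rightarrow> nat \<Rightarrow> nat list \<Rightarrow> real" where
  "crowding C m x = (\<Sum>r<m. (T ^^ r) (indicator (crowded C)) x)"

lemma crowding_nonneg: "crowding C m x \<ge> 0"
  unfolding crowding_def by (intro sum_nonneg Tpow_nonneg) auto

lemma crowding_Suc: "crowding C (Suc m) x = indicator (crowded C) x + T (crowding C m) x"
  unfolding crowding_def by (subst sum.lessThan_Suc_shift) (simp add: T_sum)

lemma increasing_crowding: "increasing (crowding C m)"
proof -
  have "increasing (indicator (crowded C))"
    unfolding increasing_def
  proof (intro allI impI)
    fix x :: "nat list" and j assume "length x = n" "j < n"
    then have "sumsq x \<le> sumsq (bump x j)"
      unfolding sumsq_def by (auto intro!: sum_mono power_mono simp: bump_def nth_list_update)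
    then show "indicator (crowded C) x \<le> (indicator (crowded C) (bump x j) :: real)"
      by (auto simp: crowded_def indicator_def)
  qed
  then have "increasing ((T ^^ r) (indicator (crowded C)))" for r by (rule increasing_Tpow)
  then show ?thesis unfolding increasing_def crowding_def by (auto intro!: sum_mono)
qed

lemma crowding_mono_time: "m \<le> m' \<Longrightarrow> crowding C m x \<le> crowding C m' x"
  unfolding crowding_def by (intro sum_mono2 Tpow_nonneg) auto

text \<open>The threshold \<open>k\<close> is such that, in an uncrowded state, at most a fraction 1
  / (4 * d) of the queues has length \<open>k\<close> or more. At higher levels the rise probability
  is then at most 1 / (4 * n), against increments that double; at lower levels the bound d / n meets
  increments that shrink by 1 / (2 * d).\<close>

lemma choice_prob_drift:
  assumes d2: "d \<ge> 2" and k: "real k ^ 2 \<ge> 4 * real d * C" "k > 0" "C > 0"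
    and x: "length x = n" "x \<notin> crowded C" and j: "j < n"
  shows "choice_prob x j * level_incr (real d) k (Suc (x ! j)) \<le> level_incr (real d) k (x ! j) / (2 * real n)"
proof (cases "x ! j < k")
  case True
  have "choice_prob x j * level_incr (real d) k (Suc (x ! j))
      \<le> real d / real n * level_incr (real d) k (Suc (x ! j))"
    using choice_prob_le[OF j, of x] level_incr_pos[of "real d" k "Suc (x ! j)"] d2
    by (intro mult_right_mono) auto
  also have "\<dots> = (real d * level_incr (real d) k (Suc (x ! j))) / real n" by simp
  also have "\<dots> = level_incr (real d) k (x ! j) / (2 * real n)"
    by (subst level_incr_Suc_low) (use True d2 in auto)
  finally show ?thesis .
next
  case False
  define v where "v = real (card {i\<in>{..<n}. x ! j \<le> x ! i}) / real n"
  have "card {i\<in>{..<n}. x ! j \<le> x ! i} \<le> card {..<n}" by (rule card_mono) auto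
  then have v1: "0 \<le> v" "v \<le> 1" using n_pos by (auto simp: v_def divide_simps)
  have "real (card {i\<in>{..<n}. x ! j \<le> x ! i}) \<le> C * real n / (real (x ! j))\<^sup>2"
    using x False k by (intro card_level_le) (auto simp: crowded_def)
  also have "\<dots> \<le> C * real n / (4 * real d * C)"
  proof (rule divide_left_mono)
    have "(real k)\<^sup>2 \<le> (real (x ! j))\<^sup>2" using False by (intro power_mono) auto
    then show "4 * real d * C \<le> (real (x ! j))\<^sup>2" using k by linarith
  qed (use k False d2 n_pos in auto)
  finally have v4: "v \<le> 1 / (4 * real d)"
    using n_pos k d2 by (simp add: v_def field_simps)
  have "choice_prob x j \<le> real d / real n * v ^ (d - 1)"
    using choice_prob_le_tail[OF j] by (simp add: v_def)
  \<comment> \<open>Here \<open>d \<ge> 2\<close> enters: at least one factor v survives, and it is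
    small at high levels.\<close>
  also have "v ^ (d - 1) \<le> v ^ 1" using v1 d2 by (intro power_decreasing) auto
  also have "v ^ 1 \<le> 1 / (4 * real d)" using v4 by simp
  finally have "choice_prob x j \<le> 1 / (4 * real n)"
    using d2 by (simp add: mult_left_mono divide_right_mono)
  then have "choice_prob x j * level_incr (real d) k (Suc (x ! j)) \<le> 1 / (4 * real n) * level_incr (real d) k (Suc (x ! j))"
    using level_incr_pos[of "real d" k "Suc (x ! j)"] d2 by (intro mult_right_mono) auto
  also have "\<dots> = level_incr (real d) k (x ! j) / (2 * real n)"
    using False by (simp add: level_incr_Suc_high)
  finally show ?thesis .
qed

text \<open>Induction on the number of remaining steps. In a crowded state the trivial bound 1 is
  paid by the indicator that \<open>crowding_Suc\<close> splits off; in an uncrowded state the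
  weight has negative drift. With H the constant of \<open>level_weight_le_incr\<close>, the rate is
  \<alpha> = 1 / (4 * H): one factor 2 is lost to upward moves, another to 1 / (1 + lam) \<ge> 1 /
  2.\<close>

lemma influence_decay:
  assumes d2: "d \<ge> 2" and lam1: "lam \<le> 1"
    and k: "real k ^ 2 \<ge> 4 * real d * C" "k > 0" "C > 0"
    and \<alpha>: "\<alpha> = 1 / (4 * ((real k + 1) * (2 * real d) ^ k + 2))"
    and g: "bump_lipschitz g" and x: "length x = n" and j: "j < n"
  shows "\<bar>(T ^^ m) g (bump x j) - (T ^^ m) g x\<bar>
    \<le> (1 - \<alpha> / real n) ^ m * level_weight (real d) k (x ! j) + crowding C m x"
  using x j
proof (induction m arbitrary: x j)
  case 0
  then have "\<bar>g (bump x j) - g x\<bar> \<le> 1" using g by (simp add: bump_lipschitz_def)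
  also have "1 \<le> level_weight (real d) k (x ! j)" using d2 by (intro level_weight_ge_1) auto
  finally show ?case by (simp add: crowding_def)
next
  case (Suc m)
  define h where "h = level_weight (real d) k"
  define \<delta> where "\<delta> = level_incr (real d) k (x ! j)"
  define \<rho> where "\<rho> = 1 - \<alpha> / real n"
  have dpos: "real d > 0" "real d \<ge> 1" using d2 by auto
  define H where "H = (real k + 1) * (2 * real d) ^ k + 2"
  have "H \<ge> 2" by (simp add: H_def)
  then have "\<alpha> \<le> 1" "\<alpha> > 0" unfolding \<alpha> H_def[symmetric] by (auto simp: divide_simps)
  then have \<rho>: "0 \<le> \<rho>" using n_pos by (simp add: \<rho>_def divide_simps)
  have hnn: "h l \<ge> 1" for l unfolding h_def using dpos by (intro level_weight_ge_1)
  show ?case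
  proof (cases "x \<in> crowded C")
    case True
    have "\<bar>(T ^^ Suc m) g (bump x j) - (T ^^ Suc m) g x\<bar> \<le> 1"
      using bump_lipschitz_Tpow[OF g, of "Suc m"] Suc.prems by (simp only: bump_lipschitz_def)
    also have "1 \<le> crowding C (Suc m) x"
      using True T_mono[of x "\<lambda>_. 0" "crowding C m"] crowding_nonneg by (simp add: crowding_Suc T_const)
    also have "\<dots> \<le> \<rho> ^ Suc m * h (x ! j) + crowding C (Suc m) x"
      using \<rho> hnn[of "x ! j"] by (simp add: mult_nonneg_nonneg)
    finally show ?thesis unfolding \<rho>_def h_def .
  next
    case False
    define p where "p = choice_prob x j"
    \<comment> \<open>Leaving from level 0 means coalescence and costs the full weight, which is the
      increment of index 0.\<close>
    have e: "h (x ! j) - (if x ! j = 0 then 0 else h (x ! j - 1)) = \<delta>"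
    proof (cases "x ! j")
      case 0
      then show ?thesis by (simp add: h_def \<delta>_def level_weight_def)
    next
      case (Suc l)
      then show ?thesis by (simp add: h_def \<delta>_def level_weight_Suc)
    qed
    have \<delta>: "\<delta> > 0" unfolding \<delta>_def using dpos by (intro level_incr_pos)
    have up: "h (x ! j + 1) - h (x ! j) = level_incr (real d) k (Suc (x ! j))"
      by (simp add: h_def level_weight_Suc)
    have "p * (h (x ! j + 1) - h (x ! j)) \<le> \<delta> / (2 * real n)"
      unfolding up p_def \<delta>_def by (rule choice_prob_drift[OF d2 k _ False]) (use Suc.prems in auto)
    moreover have "p * (h (x ! j + 1) - h (x ! j)) \<ge> 0"
      unfolding up p_def using choice_prob_nonneg level_incr_pos[of "real d"] dpos
      by (intro mult_nonneg_nonneg) (auto simp: less_imp_le)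
    ultimately have "lam * (p * (h (x ! j + 1) - h (x ! j))) \<le> \<delta> / (2 * real n)"
      using lam1 lam_pos mult_left_le_one_le[of "p * (h (x ! j + 1) - h (x ! j))" lam] by linarith
    then have "lam * p * (h (x ! j + 1) - h (x ! j)) - \<delta> / real n \<le> - (\<delta> / (2 * real n))"
      by (simp add: field_simps)
    then have "(lam * p * (h (x ! j + 1) - h (x ! j)) - \<delta> / real n) / (1 + lam) \<le> - (\<delta> / (2 * real n)) / (1 + lam)"
      using lam_pos by (intro divide_right_mono) auto
    also have "\<dots> \<le> - (\<delta> / (4 * real n))"
    proof -
      have "\<delta> / (2 * real n) / 2 \<le> \<delta> / (2 * real n) / (1 + lam)"
        using lam1 lam_pos \<delta> by (intro divide_left_mono) auto
      then show ?thesis by simp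
    qed
    also have "\<dots> \<le> - (\<alpha> / real n * h (x ! j))"
    proof -
      have "h (x ! j) \<le> \<delta> / (4 * \<alpha>)"
        using level_weight_le_incr[OF dpos(2), of k "x ! j"]
        unfolding h_def \<delta>_def \<alpha> by (simp add: field_simps)
      then show ?thesis using \<open>\<alpha> > 0\<close> n_pos by (simp add: field_simps)
    qed
    finally have drift: "h (x ! j) + (lam * p * (h (x ! j + 1) - h (x ! j)) - \<delta> / real n) / (1 + lam)
        \<le> \<rho> * h (x ! j)"
      by (simp add: \<rho>_def algebra_simps)
    have "\<bar>T ((T ^^ m) g) (bump x j) - T ((T ^^ m) g) x\<bar>
      \<le> \<rho> ^ m * h (x ! j) + (lam * choice_prob x j * (\<rho> ^ m * h (x ! j + 1) - \<rho> ^ m * h (x ! j))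
        - (\<rho> ^ m * h (x ! j) - (if x ! j = 0 then 0 else \<rho> ^ m * h (x ! j - 1))) / real n) / (1 + lam)
        + T (crowding C m) x"
    proof (rule T_bump_diff[where \<phi>="\<lambda>l. \<rho> ^ m * h l" and s="crowding C m" and g="(T ^^ m) g"])
      show "mono (\<lambda>l. \<rho> ^ m * h l)"
        using level_weight_mono[OF dpos(1), of k] \<rho>
        by (auto simp: h_def mono_def intro!: mult_left_mono)
      show "\<bar>(T ^^ m) g (bump z i) - (T ^^ m) g z\<bar> \<le> \<rho> ^ m * h (z ! i) + crowding C m z"
        if "length z = n" "i < n" for z i
        using Suc.IH[OF that] by (simp add: \<rho>_def h_def)
    qed (use Suc.prems crowding_nonneg in auto)
    also have "\<dots> = \<rho> ^ m * (h (x ! j) + (lam * p * (h (x ! j + 1) - h (x ! j)) - \<delta> / real n) / (1 + lam))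
        + T (crowding C m) x"
      unfolding e[symmetric] p_def by (simp add: algebra_simps add_divide_distrib diff_divide_distrib)
    also have "\<dots> \<le> \<rho> ^ m * (\<rho> * h (x ! j)) + T (crowding C m) x"
      using drift \<rho> by (intro add_right_mono mult_left_mono) auto
    also have "\<dots> \<le> \<rho> ^ Suc m * h (x ! j) + crowding C (Suc m) x"
      by (simp add: crowding_Suc algebra_simps)
    finally show ?thesis by (simp add: \<rho>_def h_def)
  qed
qed

end

section \<open>Conditional variance and exponential moments\<close>

lemma exp_le_quadratic:
  fixes z :: real
  assumes "z \<le> 1"
  shows "exp z \<le> 1 + z + z\<^sup>2"
proof (cases "z \<ge> 0")
  case True
  then show ?thesis using assms by (intro exp_bound) auto
next
  case False
  have "1 - z \<le> exp (- z)" using exp_ge_add_one_self[of "-z"] by simp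
  then have "exp z \<le> 1 / (1 - z)"
    using False by (simp add: exp_minus field_simps)
  also have "\<dots> \<le> 1 + z + z\<^sup>2"
  proof -
    have "(1 + z + z\<^sup>2) * (1 - z) = 1 + (- z) * z\<^sup>2"
      by (simp add: algebra_simps power2_eq_square)
    also have "\<dots> \<ge> 1" using False mult_nonneg_nonneg[of "-z" "z\<^sup>2"] by simp
    finally show ?thesis using False by (simp add: divide_le_eq)
  qed
  finally show ?thesis .
qed

context supermarket
begin

text \<open>One step changes at most one queue by one customer, so only \<open>x\<close> and its
  neighbours matter. Lower neighbours appear as states \<open>y\<close> with
  \<open>bump y j = x\<close>, the form to which \<open>bump_lipschitz\<close> applies.\<close>

lemma T_mono_near:
  assumes x: "length x = n"
    and stay: "F x \<le> G x"
    and up: "\<And>j. j < n \<Longrightarrow> F (bump x j) \<le> G (bump x j)"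
    and down: "\<And>y j. length y = n \<Longrightarrow> j < n \<Longrightarrow> bump y j = x \<Longrightarrow> F y \<le> G y"
  shows "T F x \<le> T G x"
proof -
  have "F (arrive x js) \<le> G (arrive x js)" if "js \<in> choice_tuples n d" for js
    unfolding arrive_eq_bump by (rule up) (use choice_head[OF that] in auto)
  moreover have "F (depart x j) \<le> G (depart x j)" if "j < n" for j
  proof (cases "x ! j = 0")
    case True
    then show ?thesis using stay by (simp add: depart_zero)
  next
    case False
    then show ?thesis using x that by (intro down[of _ j]) (auto simp: bump_depart)
  qed
  ultimately show ?thesis
    unfolding step_op_def arrival_op_def departure_op_def using lam_pos n_pos
    by (intro divide_right_mono add_mono mult_left_mono sum_mono) auto
qed

lemma T_near_le_const:
  assumes "length x = n" "F x \<le> c" "\<And>j. j < n \<Longrightarrow> F (bump x j) \<le> c"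
    "\<And>y j. length y = n \<Longrightarrow> j < n \<Longrightarrow> bump y j = x \<Longrightarrow> F y \<le> c"
  shows "T F x \<le> c"
  using T_mono_near[of x F "\<lambda>_. c"] assms by (simp add: T_const)

text \<open>Jumps of \<open>g\<close> are at most 1, so a squared jump is at most the jump itself,
  and no queue is hit with conditional probability above d / n. A departure is measured from the
  state below \<open>x\<close>; this is why \<open>v\<close> is monotone and \<open>s\<close>
  increasing.\<close>

lemma T_sq_diff_le:
  assumes x: "length x = n" and g: "bump_lipschitz g" and "mono v" and v0: "\<And>l. v l \<ge> 0"
    and s: "increasing s" and s0: "\<And>z. s z \<ge> 0"
    and D: "\<And>z i. length z = n \<Longrightarrow> i < n \<Longrightarrow> \<bar>g (bump z i) - g z\<bar> \<le> v (z ! i) + s z"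
  shows "T (\<lambda>y. (g y - g x)\<^sup>2) x \<le> real d / real n * (\<Sum>j<n. v (x ! j) + s x)"
proof -
  define B where "B = real d / real n * (\<Sum>j<n. v (x ! j) + s x)"
  have sq: "a\<^sup>2 \<le> \<bar>a\<bar>" if "\<bar>a\<bar> \<le> 1" for a :: real
    using mult_left_le[OF that, of "\<bar>a\<bar>"] by (simp add: power2_eq_square flip: abs_mult)
  have w0: "v l + s x \<ge> 0" for l using v0 s0 by (intro add_nonneg_nonneg)
  have up: "(g (bump x j) - g x)\<^sup>2 \<le> v (x ! j) + s x" if "j < n" for j
  proof -
    have "(g (bump x j) - g x)\<^sup>2 \<le> \<bar>g (bump x j) - g x\<bar>"
      by (rule sq) (use g x that in \<open>simp add: bump_lipschitz_def\<close>)
    also have "\<dots> \<le> v (x ! j) + s x" by (rule D[OF x that])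
    finally show ?thesis .
  qed
  have "arrival_op n d (\<lambda>y. (g y - g x)\<^sup>2) x \<le> (\<Sum>j<n. real d / real n * (v (x ! j) + s x))"
    unfolding arrival_op_eq_sum
    using choice_prob_le choice_prob_nonneg up w0 by (intro sum_mono mult_mono) auto
  then have A: "arrival_op n d (\<lambda>y. (g y - g x)\<^sup>2) x \<le> B" by (simp add: B_def sum_distrib_left)
  have down: "(g (depart x j) - g x)\<^sup>2 \<le> v (x ! j) + s x" if j: "j < n" for j
  proof (cases "x ! j = 0")
    case True
    then show ?thesis using w0 by (simp add: depart_zero)
  next
    case False
    define z where "z = depart x j"
    have z: "length z = n" "bump z j = x" "z ! j = x ! j - 1"
      using x j False bump_depart[of j x] by (auto simp: z_def) (simp add: depart_def)
    have "(g z - g x)\<^sup>2 = (g (bump z j) - g z)\<^sup>2" unfolding z(2) by (simp add: power2_commute)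
    also have "\<dots> \<le> \<bar>g (bump z j) - g z\<bar>"
      by (rule sq) (use g z(1) j in \<open>simp add: bump_lipschitz_def\<close>)
    also have "\<dots> \<le> v (z ! j) + s z" by (rule D[OF z(1) j])
    also have "\<dots> \<le> v (x ! j) + s x"
    proof (rule add_mono)
      show "v (z ! j) \<le> v (x ! j)" by (rule monoD[OF \<open>mono v\<close>]) (simp add: z(3))
      have "s z \<le> s (bump z j)" using s z(1) j by (simp add: increasing_def)
      then show "s z \<le> s x" by (simp add: z(2))
    qed
    finally show ?thesis unfolding z_def .
  qed
  have "departure_op n (\<lambda>y. (g y - g x)\<^sup>2) x \<le> (\<Sum>j<n. v (x ! j) + s x) / real n"
    unfolding departure_op_def using down by (intro divide_right_mono sum_mono) auto
  also have "\<dots> \<le> B"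
  proof -
    have "1 * ((\<Sum>j<n. v (x ! j) + s x) / real n) \<le> real d * ((\<Sum>j<n. v (x ! j) + s x) / real n)"
      using d_pos w0 by (intro mult_right_mono divide_nonneg_nonneg sum_nonneg) auto
    then show ?thesis by (simp add: B_def)
  qed
  finally have "lam * arrival_op n d (\<lambda>y. (g y - g x)\<^sup>2) x + departure_op n (\<lambda>y. (g y - g x)\<^sup>2) x
      \<le> lam * B + B"
    using A lam_pos by (intro add_mono mult_left_mono) auto
  then have "T (\<lambda>y. (g y - g x)\<^sup>2) x \<le> B"
    using lam_pos by (simp add: step_op_def divide_le_eq algebra_simps)
  then show ?thesis by (simp add: B_def)
qed

lemma T_sq_diff_le_1:
  assumes x: "length x = n" and g: "bump_lipschitz g"
  shows "T (\<lambda>y. (g y - g x)\<^sup>2) x \<le> 1"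
proof (rule T_near_le_const[OF x])
  fix y j assume y: "length y = n" "j < n" "bump y j = x"
  have "\<bar>g (bump y j) - g y\<bar> \<le> 1" using g y(1,2) by (simp add: bump_lipschitz_def)
  then have "\<bar>g y - g x\<bar> \<le> 1" using y(3) by simp
  then show "(g y - g x)\<^sup>2 \<le> 1" by (simp add: abs_square_le_1)
qed (use g x in \<open>auto simp: bump_lipschitz_def abs_square_le_1\<close>)

text \<open>Bernstein's one-step estimate. Both \<open>g y\<close> and the mean lie within 1 of
  \<open>g x\<close>, so the centred jump is at most 2, and \<theta> \<le> 1 / 2 keeps the exponent
  at most 1, where \<open>exp_le_quadratic\<close> applies. The variance about the mean is at most
  the second moment about \<open>g x\<close>.\<close>

lemma T_exp_le:
  assumes x: "length x = n" and g: "bump_lipschitz g" and \<theta>: "0 \<le> \<theta>" "\<theta> \<le> 1 / 2"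
    and V: "T (\<lambda>y. (g y - g x)\<^sup>2) x \<le> V"
  shows "T (\<lambda>y. exp (\<theta> * g y)) x \<le> exp (\<theta> * T g x + \<theta>\<^sup>2 * V)"
proof -
  define \<mu> where "\<mu> = T g x"
  have near: "\<bar>g y - g x\<bar> \<le> 1" if "length y = n" "j < n" "bump y j = x" for y j
  proof -
    have "\<bar>g (bump y j) - g y\<bar> \<le> 1" using g that(1,2) by (simp add: bump_lipschitz_def)
    then show ?thesis using that(3) by simp
  qed
  have near': "\<bar>g (bump x j) - g x\<bar> \<le> 1" if "j < n" for j
    using g that x by (simp add: bump_lipschitz_def)
  have "T (\<lambda>y. g y - g x) x \<ge> -1" 
  proof -
    have "T (\<lambda>y. - (g y - g x)) x \<le> 1"
      by (rule T_near_le_const[OF x]) (use near near' in \<open>auto simp: abs_le_iff\<close>)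
    then show ?thesis unfolding T_uminus by simp
  qed
  then have \<mu>: "g x - \<mu> \<le> 1" by (simp add: T_diff T_const \<mu>_def)
  have "T (\<lambda>y. exp (\<theta> * (g y - \<mu>))) x \<le> T (\<lambda>y. 1 + \<theta> * (g y - \<mu>) + \<theta>\<^sup>2 * (g y - \<mu>)\<^sup>2) x"
  proof -
    have *: "exp (\<theta> * (b - \<mu>)) \<le> 1 + \<theta> * (b - \<mu>) + \<theta>\<^sup>2 * (b - \<mu>)\<^sup>2" if "\<bar>b - g x\<bar> \<le> 1" for b
    proof -
      have "b - \<mu> \<le> 2" using that \<mu> by linarith
      then have "\<theta> * (b - \<mu>) \<le> \<theta> * 2" using \<theta> by (intro mult_left_mono)
      then have "\<theta> * (b - \<mu>) \<le> 1" using \<theta> by linarith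
      from exp_le_quadratic[OF this] show ?thesis by (simp add: power_mult_distrib)
    qed
    show ?thesis by (rule T_mono_near[OF x]; rule *) (use near near' in auto)
  qed
  also have "\<dots> = 1 + \<theta>\<^sup>2 * T (\<lambda>y. (g y - \<mu>)\<^sup>2) x"
    by (simp add: T_add T_const T_cmult T_diff \<mu>_def)
  also have "T (\<lambda>y. (g y - \<mu>)\<^sup>2) x \<le> V"
  proof -
    have eq: "(g y - \<mu>)\<^sup>2 = (g y - g x)\<^sup>2 + ((- 2 * (\<mu> - g x)) * (g y - g x) + (\<mu> - g x)\<^sup>2)" for y
      by (simp add: power2_eq_square algebra_simps)
    have "T (\<lambda>y. (g y - \<mu>)\<^sup>2) x = T (\<lambda>y. (g y - g x)\<^sup>2) x + (- 2 * (\<mu> - g x) * (\<mu> - g x) + (\<mu> - g x)\<^sup>2)"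
      unfolding eq T_add T_cmult T_const T_diff[of g "\<lambda>_. g x"] \<mu>_def[symmetric] by simp
    also have "\<dots> = T (\<lambda>y. (g y - g x)\<^sup>2) x - (\<mu> - g x)\<^sup>2"
      by (simp add: power2_eq_square algebra_simps)
    finally show ?thesis using V zero_le_power2[of "\<mu> - g x"] by linarith
  qed
  also have "1 + \<theta>\<^sup>2 * V \<le> exp (\<theta>\<^sup>2 * V)" by (rule exp_ge_add_one_self)
  finally have "exp (\<theta> * \<mu>) * T (\<lambda>y. exp (\<theta> * (g y - \<mu>))) x \<le> exp (\<theta> * \<mu>) * exp (\<theta>\<^sup>2 * V)"
    by (simp add: mult_left_mono)
  then show ?thesis
    unfolding T_cmult[of "exp (\<theta> * \<mu>)", symmetric] exp_add[symmetric] by (simp add: algebra_simps \<mu>_def)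
qed

text \<open>
  A Freedman-type bound by backward induction: the exponential moment of the martingale
  \<open>(T ^^ r) f\<close> evaluated along the chain is followed only as long as the chain avoids the set where the
  conditional variance may exceed its budget.
\<close>

lemma Tpow_tail_le:
  assumes f: "bump_lipschitz f" and \<theta>: "0 \<le> \<theta>" "\<theta> \<le> 1 / 2"
    and V: "\<And>x r. length x = n \<Longrightarrow> x \<notin> Bad \<Longrightarrow> r < t \<Longrightarrow>
        T (\<lambda>y. ((T ^^ r) f y - (T ^^ r) f x)\<^sup>2) x \<le> V r"
    and "r \<le> t" "length x = n"
  shows "(T ^^ r) (indicator {y. a \<le> f y}) x
    \<le> exp (\<theta> * ((T ^^ r) f x - a) + \<theta>\<^sup>2 * (\<Sum>i<r. V i)) + (\<Sum>i<r. (T ^^ i) (indicator Bad) x)"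
  using assms(5,6)
proof (induction r arbitrary: x)
  case 0
  then show ?case using \<theta> by (auto simp: indicator_def)
next
  case (Suc r)
  let ?F = "indicator {y. a \<le> f y} :: nat list \<Rightarrow> real"
  have shift: "(\<Sum>i<Suc r. (T ^^ i) (indicator Bad) x)
      = indicator Bad x + T (\<lambda>y. \<Sum>i<r. (T ^^ i) (indicator Bad) y) x"
    by (subst sum.lessThan_Suc_shift) (simp add: T_sum)
  show ?case
  proof (cases "x \<in> Bad")
    case True
    \<comment> \<open>In \<open>Bad\<close> the tail probability is bounded by 1, which the summand
      i = 0 pays.\<close>
    have "(T ^^ Suc r) ?F x \<le> (T ^^ Suc r) (\<lambda>_. 1) x"
      by (rule Tpow_mono) (auto simp: indicator_def)
    then have "(T ^^ Suc r) ?F x \<le> 1" by (simp only: Tpow_const)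
    moreover have "0 \<le> T (\<lambda>y. \<Sum>i<r. (T ^^ i) (indicator Bad) y) x"
      using Tpow_nonneg[of "\<lambda>y. \<Sum>i<r. (T ^^ i) (indicator Bad) y" 1 x]
      by (simp add: sum_nonneg Tpow_nonneg)
    ultimately show ?thesis using True unfolding shift by (simp add: add_increasing)
  next
    case False
    let ?S = "\<theta>\<^sup>2 * (\<Sum>i<r. V i)"
    have "T ((T ^^ r) ?F) x \<le> T (\<lambda>y. exp (?S - \<theta> * a) * exp (\<theta> * (T ^^ r) f y)
        + (\<Sum>i<r. (T ^^ i) (indicator Bad) y)) x"
    proof (rule T_mono)
      fix y :: "nat list" assume "length y = length x"
      then have "(T ^^ r) ?F y \<le> exp (\<theta> * ((T ^^ r) f y - a) + ?S) + (\<Sum>i<r. (T ^^ i) (indicator Bad) y)"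
        using Suc by auto
      then show "(T ^^ r) ?F y \<le> exp (?S - \<theta> * a) * exp (\<theta> * (T ^^ r) f y) + (\<Sum>i<r. (T ^^ i) (indicator Bad) y)"
        by (simp add: algebra_simps flip: exp_add)
    qed
    also have "\<dots> = exp (?S - \<theta> * a) * T (\<lambda>y. exp (\<theta> * (T ^^ r) f y)) x
        + T (\<lambda>y. \<Sum>i<r. (T ^^ i) (indicator Bad) y) x"
      by (simp only: T_add T_cmult)
    also have "\<dots> \<le> exp (?S - \<theta> * a) * exp (\<theta> * T ((T ^^ r) f) x + \<theta>\<^sup>2 * V r)
        + T (\<lambda>y. \<Sum>i<r. (T ^^ i) (indicator Bad) y) x"
    proof (intro add_right_mono mult_left_mono)
      show "T (\<lambda>y. exp (\<theta> * (T ^^ r) f y)) x \<le> exp (\<theta> * T ((T ^^ r) f) x + \<theta>\<^sup>2 * V r)"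
        by (rule T_exp_le) (use Suc.prems bump_lipschitz_Tpow[OF f] \<theta> V[OF _ False] in auto)
    qed simp
    also have "exp (?S - \<theta> * a) * exp (\<theta> * T ((T ^^ r) f) x + \<theta>\<^sup>2 * V r)
        = exp (\<theta> * ((T ^^ Suc r) f x - a) + \<theta>\<^sup>2 * (\<Sum>i<Suc r. V i))"
      by (simp add: algebra_simps flip: exp_add)
    finally show ?thesis unfolding shift using False by simp
  qed
qed

lemma Tpow_concentration_one_sided:
  assumes f: "bump_lipschitz f" and x: "length x = n" and u: "u > 0"
    and V: "\<And>x r. length x = n \<Longrightarrow> x \<notin> Bad \<Longrightarrow> r < t \<Longrightarrow>
        T (\<lambda>y. ((T ^^ r) f y - (T ^^ r) f x)\<^sup>2) x \<le> V r"
    and W: "(\<Sum>i<t. V i) \<le> W" "W \<ge> 0"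
  shows "(T ^^ t) (indicator {y. (T ^^ t) f x + u \<le> f y}) x
    \<le> exp (- u\<^sup>2 / (4 * (W + u))) + (\<Sum>i<t. (T ^^ i) (indicator Bad) x)"
proof -
  \<comment> \<open>The minimiser of - \<theta> * u + \<theta>^2 * (W + u). Having u in the
    denominator ensures \<theta> \<le> 1 / 2 and produces the Bernstein form of the
    exponent.\<close>
  define \<theta> where "\<theta> = u / (2 * (W + u))"
  have Wu: "W + u > 0" using W u by simp
  have \<theta>: "0 \<le> \<theta>" "\<theta> \<le> 1 / 2" using W u by (auto simp: \<theta>_def divide_simps)
  have "\<theta> * ((T ^^ t) f x - ((T ^^ t) f x + u)) + \<theta>\<^sup>2 * (\<Sum>i<t. V i) \<le> - \<theta> * u + \<theta>\<^sup>2 * (W + u)"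
  proof -
    have "\<theta>\<^sup>2 * (\<Sum>i<t. V i) \<le> \<theta>\<^sup>2 * (W + u)" using W u by (intro mult_left_mono) auto
    then show ?thesis by simp
  qed
  also have "\<dots> = - u\<^sup>2 / (4 * (W + u))"
  proof -
    have "\<theta> * (W + u) = u / 2" using Wu unfolding \<theta>_def by (simp add: field_simps)
    then have "\<theta>\<^sup>2 * (W + u) = \<theta> * (u / 2)" by (simp only: power2_eq_square mult.assoc)
    then have "- \<theta> * u + \<theta>\<^sup>2 * (W + u) = - (\<theta> * u / 2)" by simp
    also have "\<theta> * u / 2 = u\<^sup>2 / (4 * (W + u))"
      by (simp add: \<theta>_def power2_eq_square algebra_simps)
    finally show ?thesis by simp
  qed
  finally have "exp (\<theta> * ((T ^^ t) f x - ((T ^^ t) f x + u)) + \<theta>\<^sup>2 * (\<Sum>i<t. V i)) \<le> exp (- u\<^sup>2 / (4 * (W + u)))"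
    by simp
  moreover have "(T ^^ t) (indicator {y. (T ^^ t) f x + u \<le> f y}) x
      \<le> exp (\<theta> * ((T ^^ t) f x - ((T ^^ t) f x + u)) + \<theta>\<^sup>2 * (\<Sum>i<t. V i))
        + (\<Sum>i<t. (T ^^ i) (indicator Bad) x)"
    by (rule Tpow_tail_le[OF f \<theta> _ order.refl x]) (rule V)
  ultimately show ?thesis by linarith
qed

text \<open>The two tails are the upper tails of \<open>f\<close> and of its negative; this is why
  the variance budget is assumed for every \<open>g\<close>.\<close>

lemma Tpow_concentration:
  assumes f: "bump_lipschitz f" and x: "length x = n" and u: "u > 0"
    and V: "\<And>g x r. bump_lipschitz g \<Longrightarrow> length x = n \<Longrightarrow> x \<notin> Bad \<Longrightarrow> r < t \<Longrightarrow>
        T (\<lambda>y. ((T ^^ r) g y - (T ^^ r) g x)\<^sup>2) x \<le> V r"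
    and W: "(\<Sum>i<t. V i) \<le> W" "W \<ge> 0"
  shows "(T ^^ t) (indicator {y. \<bar>f y - (T ^^ t) f x\<bar> \<ge> u}) x
    \<le> 2 * exp (- u\<^sup>2 / (4 * (W + u))) + 2 * (\<Sum>i<t. (T ^^ i) (indicator Bad) x)"
proof -
  let ?a = "(T ^^ t) f x"
  have f': "bump_lipschitz (\<lambda>y. - f y)" using f by (force simp: bump_lipschitz_def)
  have "(T ^^ t) (indicator {y. \<bar>f y - ?a\<bar> \<ge> u}) x
      \<le> (T ^^ t) (\<lambda>y. indicator {y. ?a + u \<le> f y} y + indicator {y. - ?a + u \<le> - f y} y) x"
    by (rule Tpow_mono) (auto simp: indicator_def)
  also have "\<dots> = (T ^^ t) (indicator {y. ?a + u \<le> f y}) x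
      + (T ^^ t) (indicator {y. (T ^^ t) (\<lambda>y. - f y) x + u \<le> - f y}) x"
    by (simp only: Tpow_add Tpow_uminus)
  also have "\<dots> \<le> (exp (- u\<^sup>2 / (4 * (W + u))) + (\<Sum>i<t. (T ^^ i) (indicator Bad) x))
      + (exp (- u\<^sup>2 / (4 * (W + u))) + (\<Sum>i<t. (T ^^ i) (indicator Bad) x))"
    by (rule add_mono;
        rule Tpow_concentration_one_sided[OF _ x u _ W, of _ Bad]; (rule f f' V[OF f] V[OF f'])?; assumption?)
  finally show ?thesis by simp
qed

end

section \<open>Comparison with uniform routing\<close>

text \<open>
  Monotonicity with respect to weak majorization of two coordinates; it contains symmetry and
  coordinatewise monotonicity.
\<close>

definition weakly_majorized :: "nat \<Rightarrow> nat \<Rightarrow> nat \<Rightarrow> nat \<Rightarrow> bool" where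
  "weakly_majorized a b a' b' \<longleftrightarrow> max a b \<le> max a' b' \<and> a + b \<le> a' + b'"

definition schur_increasing :: "nat \<Rightarrow> (nat list \<Rightarrow> real) \<Rightarrow> bool" where
  "schur_increasing n F \<longleftrightarrow> (\<forall>x i j a b a' b'. length x = n \<longrightarrow> i < n \<longrightarrow> j < n \<longrightarrow> i \<noteq> j \<longrightarrow>
     weakly_majorized a b a' b' \<longrightarrow> F (x[i := a, j := b]) \<le> F (x[i := a', j := b']))"

text \<open>Match an arrival at the longer queue of one pair with an arrival at the longer queue of
  the other, and shorter with shorter. The matching is parallel or crossed according to whether the
  two pairs are ordered alike.\<close>

lemma weakly_majorized_arrival:
  assumes "weakly_majorized a b a' b'"
  shows "(weakly_majorized (a + 1) b (a' + 1) b' \<and> weakly_majorized a (b + 1) a' (b' + 1)) \<or>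
         (weakly_majorized (a + 1) b a' (b' + 1) \<and> weakly_majorized a (b + 1) (a' + 1) b')"
proof (cases "b \<le> a \<longleftrightarrow> b' \<le> a'")
  case True
  then show ?thesis
    using assms by (intro disjI1) (cases "b \<le> a"; simp add: weakly_majorized_def le_max_iff_disj; presburger)
next
  case False
  then show ?thesis
    using assms by (intro disjI2) (cases "b \<le> a"; simp add: weakly_majorized_def le_max_iff_disj; presburger)
qed

text \<open>The same matching as for arrivals. Truncation at 0 does no harm: if the shorter queue of
  the smaller pair is empty, the comparison of maxima already yields that of the sums after the
  departure.\<close>

lemma weakly_majorized_departure:
  assumes "weakly_majorized a b a' b'"
  shows "(weakly_majorized (a - 1) b (a' - 1) b' \<and> weakly_majorized a (b - 1) a' (b' - 1)) \<or>
         (weakly_majorized (a - 1) b a' (b' - 1) \<and> weakly_majorized a (b - 1) (a' - 1) b')"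
proof (cases "b \<le> a \<longleftrightarrow> b' \<le> a'")
  case True
  then show ?thesis
    using assms by (intro disjI1) (cases "b \<le> a"; cases a; cases b; cases a'; cases b';
      auto simp: weakly_majorized_def le_max_iff_disj)
next
  case False
  then show ?thesis
    using assms by (intro disjI2) (cases "b \<le> a"; cases a; cases b; cases a'; cases b';
      auto simp: weakly_majorized_def le_max_iff_disj)
qed

text \<open>Sums of a convex increasing function respect weak majorization. For squares, if the
  minimum drops, this amounts to multiplying the comparison of differences by that of sums.\<close>

lemma weakly_majorized_sum_squares:
  assumes "weakly_majorized a b a' b'"
  shows "(real a)\<^sup>2 + (real b)\<^sup>2 \<le> (real a')\<^sup>2 + (real b')\<^sup>2"
proof -
  have *: "p\<^sup>2 + q\<^sup>2 \<le> p'\<^sup>2 + q'\<^sup>2" if "p \<le> p'" "p + q \<le> p' + q'" "q \<le> p" "0 \<le> q" "0 \<le> q'" "q' \<le> p'"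
    for p q p' q' :: real
  proof (cases "q \<le> q'")
    case True
    then show ?thesis using that by (intro add_mono power_mono) auto
  next
    case False
    have "(q - q') * (q + q') \<le> (p' - p) * (p' + p)"
      using that False by (intro mult_mono) auto
    then show ?thesis by (simp add: algebra_simps power2_eq_square)
  qed
  have "(max (real a) (real b))\<^sup>2 + (min (real a) (real b))\<^sup>2
      \<le> (max (real a') (real b'))\<^sup>2 + (min (real a') (real b'))\<^sup>2"
    by (rule *) (use assms in \<open>auto simp: weakly_majorized_def max_def min_def split: if_splits\<close>)
  then show ?thesis by (auto simp: max_def min_def split: if_splits)
qed

text \<open>Under uniform routing the queue may be drawn before the type of event. Each queue then
  performs its own birth-and-death step, and stationarity can be checked queue by queue.\<close>

definition site_step :: "real \<Rightarrow> (nat list \<Rightarrow> real) \<Rightarrow> nat list \<Rightarrow> nat \<Rightarrow> real" where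
  "site_step lam F x k = (lam * F (bump x k) + F (depart x k)) / (1 + lam)"

definition uniform_op :: "nat \<Rightarrow> real \<Rightarrow> (nat list \<Rightarrow> real) \<Rightarrow> nat list \<Rightarrow> real" where
  "uniform_op n lam F x = (\<Sum>k<n. site_step lam F x k) / real n"

lemma schur_increasingD:
  assumes "schur_increasing n F" "length x = n" "i < n" "j < n" "i \<noteq> j" "weakly_majorized a b a' b'"
  shows "F (x[i := a, j := b]) \<le> F (x[i := a', j := b'])"
  using assms unfolding schur_increasing_def by blast

text \<open>Events at a third queue commute with the two updates. Events at \<open>i\<close> and
  \<open>j\<close> are compared only as a sum, since the matching of arrivals or departures may
  cross the two queues.\<close>

lemma schur_increasing_uniform_op:
  assumes lam: "0 < lam" and F: "schur_increasing n F"
  shows "schur_increasing n (uniform_op n lam F)"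
  unfolding schur_increasing_def
proof (intro allI impI)
  fix x :: "nat list" and i j a b a' b'
  assume x: "length x = n" and ij: "i < n" "j < n" "i \<noteq> j" and m: "weakly_majorized a b a' b'"
  let ?y = "x[i := a, j := b]" and ?y' = "x[i := a', j := b']"
  note D = schur_increasingD[OF F x ij]
  have other: "site_step lam F ?y k \<le> site_step lam F ?y' k" if k: "k < n" "k \<noteq> i" "k \<noteq> j" for k
  proof -
    have sw: "x[i := c, j := e, k := v] = x[k := v, i := c, j := e]" for c e v
      using k by (metis list_update_swap)
    have "F (x[k := v, i := a, j := b]) \<le> F (x[k := v, i := a', j := b'])" for v
      by (rule schur_increasingD[OF F _ ij m]) (use x in auto)
    then show ?thesis
      unfolding site_step_def bump_def depart_def using k lam
      by (intro divide_right_mono add_mono mult_left_mono) (auto simp: sw)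
  qed
  have site: "site_step lam F (x[i := c, j := e]) i + site_step lam F (x[i := c, j := e]) j
     = (lam * (F (x[i := c + 1, j := e]) + F (x[i := c, j := e + 1]))
        + (F (x[i := c - 1, j := e]) + F (x[i := c, j := e - 1]))) / (1 + lam)" for c e
    using x ij unfolding site_step_def bump_def depart_def
    by (simp add: list_update_swap[of i j] algebra_simps flip: add_divide_distrib)
  have up: "F (x[i := a + 1, j := b]) + F (x[i := a, j := b + 1])
      \<le> F (x[i := a' + 1, j := b']) + F (x[i := a', j := b' + 1])"
    using weakly_majorized_arrival[OF m] D add_mono add.commute by (smt (verit))
  have down: "F (x[i := a - 1, j := b]) + F (x[i := a, j := b - 1])
      \<le> F (x[i := a' - 1, j := b']) + F (x[i := a', j := b' - 1])"
    using weakly_majorized_departure[OF m] D add_mono add.commute by (smt (verit))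
  have pair: "site_step lam F ?y i + site_step lam F ?y j
      \<le> site_step lam F ?y' i + site_step lam F ?y' j"
    unfolding site
    by (rule divide_right_mono[OF add_mono[OF mult_left_mono[OF up] down]]) (use lam in auto)
  have split: "(\<Sum>k<n. h k) = h i + h j + (\<Sum>k\<in>{..<n} - {i, j}. h k)" for h :: "nat \<Rightarrow> real"
  proof -
    have "(\<Sum>k<n. h k) = (\<Sum>k\<in>{i, j}. h k) + (\<Sum>k\<in>{..<n} - {i, j}. h k)"
      using ij by (subst sum.subset_diff[of "{i, j}"]) auto
    then show ?thesis using ij by simp
  qed
  have "(\<Sum>k<n. site_step lam F ?y k) \<le> (\<Sum>k<n. site_step lam F ?y' k)"
    unfolding split using pair other by (intro add_mono[OF pair] sum_mono) auto
  then show "uniform_op n lam F ?y \<le> uniform_op n lam F ?y'"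
    unfolding uniform_op_def by (intro divide_right_mono) auto
qed

lemma schur_increasing_uniform_op_pow:
  "0 < lam \<Longrightarrow> schur_increasing n F \<Longrightarrow> schur_increasing n ((uniform_op n lam ^^ t) F)"
  by (induction t) (auto intro: schur_increasing_uniform_op)

text \<open>Raising one entry of a pair is a weak majorization; \<open>n \<ge> 2\<close> provides
  the second coordinate, which keeps its value.\<close>

lemma schur_increasing_update_le:
  assumes F: "schur_increasing n F" and n: "n \<ge> 2" and x: "length x = n" and i: "i < n" and ab: "a \<le> b"
  shows "F (x[i := a]) \<le> F (x[i := b])"
proof -
  obtain j where j: "j < n" "j \<noteq> i"
    using n by (metis One_nat_def Suc_1 Suc_le_lessD lessI less_trans zero_less_Suc zero_neq_one)
  have "F (x[i := a, j := x ! j]) \<le> F (x[i := b, j := x ! j])"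
    using ab j i x by (intro schur_increasingD[OF F]) (auto simp: weakly_majorized_def)
  moreover have "x[i := c, j := x ! j] = x[i := c]" for c
    using j by (metis list_update_id nth_list_update_neq)
  ultimately show ?thesis by simp
qed

lemma schur_increasing_zero_le:
  assumes F: "schur_increasing n F" and n: "n \<ge> 2" and x: "length x = n"
  shows "F (replicate n 0) \<le> F x"
proof -
  have "F (replicate k 0 @ drop k x) \<le> F x" if "k \<le> n" for k
    using that
  proof (induction k)
    case (Suc k)
    let ?y = "replicate k 0 @ drop k x"
    have len: "length ?y = n" using Suc.prems x by simp
    have "drop k x = x ! k # drop (Suc k) x"
      using Suc.prems x by (simp add: Cons_nth_drop_Suc)
    then have 1: "replicate (Suc k) 0 @ drop (Suc k) x = ?y[k := 0]"
      by (simp add: list_update_append replicate_append_same)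
    have "F (?y[k := 0]) \<le> F (?y[k := ?y ! k])"
      by (rule schur_increasing_update_le[OF F n len]) (use Suc.prems in auto)
    then show ?case unfolding 1 using Suc by simp
  qed simp
  from this[of n] show ?thesis using x by simp
qed

lemma schur_increasing_sumsq_indicator: "schur_increasing n (indicator {x. c < sumsq x})"
  unfolding schur_increasing_def
proof (intro allI impI)
  fix x :: "nat list" and i j a b a' b'
  assume x: "length x = n" and ij: "i < n" "j < n" "i \<noteq> j" and m: "weakly_majorized a b a' b'"
  have split: "sumsq (x[i := c, j := e])
      = ((real c)\<^sup>2 + (real e)\<^sup>2) + (\<Sum>k\<in>{..<n} - {i, j}. (real (x ! k))\<^sup>2)" for c e
  proof -
    let ?h = "\<lambda>k. (real (x[i := c, j := e] ! k))\<^sup>2"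
    have "sumsq (x[i := c, j := e]) = (\<Sum>k\<in>{i, j}. ?h k) + (\<Sum>k\<in>{..<n} - {i, j}. ?h k)"
      unfolding sumsq_def using ij x by (subst sum.subset_diff[of "{i, j}"]) auto
    also have "(\<Sum>k\<in>{i, j}. ?h k) = (real c)\<^sup>2 + (real e)\<^sup>2" using ij x by simp
    also have "(\<Sum>k\<in>{..<n} - {i, j}. ?h k) = (\<Sum>k\<in>{..<n} - {i, j}. (real (x ! k))\<^sup>2)"
      by (intro sum.cong) auto
    finally show ?thesis .
  qed
  have "sumsq (x[i := a, j := b]) \<le> sumsq (x[i := a', j := b'])"
    unfolding split using weakly_majorized_sum_squares[OF m] by simp
  then show "indicator {x. c < sumsq x} (x[i := a, j := b])
      \<le> (indicator {x. c < sumsq x} (x[i := a', j := b']) :: real)"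
    by (auto simp: indicator_def)
qed

section \<open>Domination of the supermarket chain by uniform routing\<close>

context supermarket
begin

lemma arrival_op_hd: "(\<Sum>js\<in>choice_tuples n d. G (hd js)) / real n ^ d = (\<Sum>k<n. G k) / real n"
proof -
  obtain e where e: "d = Suc e" using d_pos by (cases d) auto
  have "(\<Sum>js\<in>choice_tuples n d. G (hd js)) = (\<Sum>p\<in>{..<n} \<times> choice_tuples n e. G (fst p))"
    by (rule sum.reindex_bij_witness[of _ "\<lambda>p. fst p # snd p" "\<lambda>js. (hd js, tl js)"])
       (auto simp: choice_tuples_def e length_Suc_conv)
  also have "\<dots> = (\<Sum>k<n. \<Sum>js\<in>choice_tuples n e. G k)"
    by (subst sum.cartesian_product) (simp add: case_prod_unfold)
  also have "\<dots> = real n ^ e * (\<Sum>k<n. G k)"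
    by (simp add: card_choice_tuples sum_distrib_left)
  finally show ?thesis using n_pos by (simp add: e)
qed

text \<open>Send the arrival to the head of the tuple, which is a uniform queue, instead of the
  shortest queue in it. Adding a customer to a longer queue rather than a shorter one moves upwards
  in weak majorization.\<close>

lemma T_le_uniform_op:
  assumes F: "schur_increasing n F" and x: "length x = n"
  shows "T F x \<le> uniform_op n lam F x"
proof -
  have "F (arrive x js) \<le> F (bump x (hd js))" if js: "js \<in> choice_tuples n d" for js
  proof -
    let ?J = "arg_min_list ((!) x) js"
    have le: "x ! ?J \<le> x ! hd js"
      using choice_head(1)[OF js] by (intro arg_min_list_le) auto
    show ?thesis
    proof (cases "?J = hd js")
      case False
      have "F (x[?J := x ! ?J + 1, hd js := x ! hd js]) \<le> F (x[?J := x ! ?J, hd js := x ! hd js + 1])"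
        by (rule schur_increasingD[OF F x]) (use choice_head[OF js] le False in \<open>auto simp: weakly_majorized_def\<close>)
      moreover have "x[?J := x ! ?J + 1, hd js := x ! hd js] = bump x ?J"
        using False by (metis bump_def list_update_id nth_list_update_neq)
      ultimately show ?thesis by (simp add: arrive_eq_bump bump_def)
    qed (simp add: arrive_eq_bump)
  qed
  then have "arrival_op n d F x \<le> (\<Sum>js\<in>choice_tuples n d. F (bump x (hd js))) / real n ^ d"
    unfolding arrival_op_def by (intro divide_right_mono sum_mono) auto
  also have "\<dots> = (\<Sum>k<n. F (bump x k)) / real n" by (rule arrival_op_hd)
  finally have "T F x \<le> (lam * ((\<Sum>k<n. F (bump x k)) / real n) + departure_op n F x) / (1 + lam)"
    unfolding step_op_def using lam_pos by (intro divide_right_mono add_mono mult_left_mono) auto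
  also have "\<dots> = uniform_op n lam F x"
    unfolding uniform_op_def site_step_def departure_op_def
    by (simp add: sum.distrib sum_distrib_left mult.commute flip: sum_divide_distrib add_divide_distrib)
  finally show ?thesis .
qed

text \<open>After the induction hypothesis \<open>T\<close> acts on a power of
  \<open>uniform_op\<close>, so it is under uniform routing that \<open>schur_increasing\<close> has
  to propagate.\<close>

lemma Tpow_le_uniform_op_pow:
  assumes F: "schur_increasing n F"
  shows "length x = n \<Longrightarrow> (T ^^ t) F x \<le> (uniform_op n lam ^^ t) F x"
proof (induction t arbitrary: x)
  case (Suc t)
  have "T ((T ^^ t) F) x \<le> T ((uniform_op n lam ^^ t) F) x"
    using Suc by (intro T_mono) auto
  also have "\<dots> \<le> uniform_op n lam ((uniform_op n lam ^^ t) F) x"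
    using schur_increasing_uniform_op_pow[OF lam_pos F] Suc.prems by (intro T_le_uniform_op)
  finally show ?case by simp
qed simp

end

section \<open>Stationarity of the product of geometric laws under uniform routing\<close>

lemma bind_geometric_birth_death:
  assumes lam: "0 < lam" "lam < 1"
  shows "bind_pmf (geometric_pmf (1 - lam))
      (\<lambda>k. map_pmf (\<lambda>b. if b then k + 1 else k - 1) (bernoulli_pmf (lam / (1 + lam))))
    = geometric_pmf (1 - lam)" (is "bind_pmf ?G _ = _")
proof -
  have p: "lam / (1 + lam) \<in> {0..1}" "1 - lam / (1 + lam) = 1 / (1 + lam)"
    using lam by (auto simp: field_simps)
  \<comment> \<open>Drawing the direction first exhibits the new law as a mixture of two shifted
    geometric laws. Because subtraction is truncated, the downward shift sends both 0 and 1 to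
    0.\<close>
  have "bind_pmf ?G (\<lambda>k. map_pmf (\<lambda>b. if b then k + 1 else k - 1) (bernoulli_pmf (lam / (1 + lam))))
      = bind_pmf (bernoulli_pmf (lam / (1 + lam))) (\<lambda>b. map_pmf (\<lambda>k. if b then k + 1 else k - 1) ?G)"
    unfolding map_pmf_def by (rule bind_commute_pmf)
  also have "\<dots> = ?G"
  proof (rule pmf_eqI)
    fix k
    have up: "pmf (map_pmf (\<lambda>k. k + 1) ?G) k = (if k = 0 then 0 else lam ^ (k - 1) * (1 - lam))"
    proof (cases k)
      case 0
      then show ?thesis by (auto simp: pmf_eq_0_set_pmf)
    next
      case (Suc m)
      have "pmf (map_pmf Suc ?G) (Suc m) = pmf ?G m" by (rule pmf_map_inj') simp
      then show ?thesis using Suc lam by simp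
    qed
    have down: "pmf (map_pmf (\<lambda>k. k - 1) ?G) k
        = lam ^ (k + 1) * (1 - lam) + (if k = 0 then 1 - lam else 0)"
    proof -
      have "pmf (map_pmf (\<lambda>k. k - 1) ?G) k = measure_pmf.prob ?G ((\<lambda>k. k - 1) -` {k})"
        by (rule pmf_map)
      also have "(\<lambda>k. k - 1) -` {k} = (if k = 0 then {0, 1} else {k + 1})" by auto
      also have "measure_pmf.prob ?G \<dots> = lam ^ (k + 1) * (1 - lam) + (if k = 0 then 1 - lam else 0)"
        using lam by (simp add: measure_measure_pmf_finite)
      finally show ?thesis .
    qed
    have "pmf (bind_pmf (bernoulli_pmf (lam / (1 + lam))) (\<lambda>b. map_pmf (\<lambda>k. if b then k + 1 else k - 1) ?G)) k
      = lam / (1 + lam) * pmf (map_pmf (\<lambda>k. k + 1) ?G) k + 1 / (1 + lam) * pmf (map_pmf (\<lambda>k. k - 1) ?G) k"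
      using p by (simp add: pmf_bind)
    also have "\<dots> = (lam * pmf (map_pmf (\<lambda>k. k + 1) ?G) k + pmf (map_pmf (\<lambda>k. k - 1) ?G) k) / (1 + lam)"
      by (simp add: add_divide_distrib)
    also have "lam * pmf (map_pmf (\<lambda>k. k + 1) ?G) k + pmf (map_pmf (\<lambda>k. k - 1) ?G) k
        = (lam ^ k * (1 - lam)) * (1 + lam)"
      unfolding up down by (cases k) (auto simp: algebra_simps)
    also have "\<dots> / (1 + lam) = lam ^ k * (1 - lam)" using lam by simp
    also have "\<dots> = pmf ?G k" using lam by simp
    finally show "pmf (bind_pmf (bernoulli_pmf (lam / (1 + lam))) (\<lambda>b. map_pmf (\<lambda>k. if b then k + 1 else k - 1) ?G)) k
      = pmf ?G k" .
  qed
  finally show ?thesis .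
qed

lemma bind_replicate_pmf_site:
  assumes p: "bind_pmf p K = p" and "j < n"
  shows "bind_pmf (replicate_pmf n p) (\<lambda>x. map_pmf (\<lambda>k. x[j := k]) (K (x ! j))) = replicate_pmf n p"
  using \<open>j < n\<close>
proof (induction n arbitrary: j)
  case (Suc n)
  show ?case
  proof (cases j)
    case 0
    have "bind_pmf (replicate_pmf (Suc n) p) (\<lambda>x. map_pmf (\<lambda>k. x[j := k]) (K (x ! j)))
        = bind_pmf p (\<lambda>a. bind_pmf (replicate_pmf n p) (\<lambda>x. bind_pmf (K a) (\<lambda>k. return_pmf (k # x))))"
      by (simp add: 0 bind_assoc_pmf bind_return_pmf map_pmf_def)
    also have "\<dots> = bind_pmf p (\<lambda>a. bind_pmf (K a) (\<lambda>k. bind_pmf (replicate_pmf n p) (\<lambda>x. return_pmf (k # x))))"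
      by (subst (2) bind_commute_pmf) (rule refl)
    also have "\<dots> = bind_pmf (bind_pmf p K) (\<lambda>k. bind_pmf (replicate_pmf n p) (\<lambda>x. return_pmf (k # x)))"
      by (simp add: bind_assoc_pmf)
    finally show ?thesis by (simp add: p)
  next
    case (Suc i)
    have "bind_pmf (replicate_pmf (Suc n) p) (\<lambda>x. map_pmf (\<lambda>k. x[j := k]) (K (x ! j)))
        = bind_pmf p (\<lambda>a. bind_pmf (bind_pmf (replicate_pmf n p) (\<lambda>x. map_pmf (\<lambda>k. x[i := k]) (K (x ! i))))
            (\<lambda>x. return_pmf (a # x)))"
      by (simp add: Suc bind_assoc_pmf bind_return_pmf map_pmf_def)
    then show ?thesis using Suc.IH[of i] Suc.prems Suc by simp
  qed
qed simp

lemma nn_integral_replicate_pmf_prod: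
  fixes h :: "'a \<Rightarrow> ennreal"
  shows "(\<integral>\<^sup>+x. prod_list (map h x) \<partial>replicate_pmf n p) = (\<integral>\<^sup>+k. h k \<partial>p) ^ n"
  by (induction n) (simp_all add: nn_integral_cmult nn_integral_multc)

lemma nn_integral_replicate_pmf_sum:
  fixes h :: "'a \<Rightarrow> ennreal"
  shows "(\<integral>\<^sup>+x. sum_list (map h x) \<partial>replicate_pmf n p) = of_nat n * (\<integral>\<^sup>+k. h k \<partial>p)"
  by (induction n) (simp_all add: nn_integral_add distrib_right)

lemma nn_integral_site_step:
  assumes lam: "0 < lam" "lam < 1" and F: "\<And>x. 0 \<le> F x" and j: "j < n"
  shows "(\<integral>\<^sup>+x. ennreal (site_step lam F x j) \<partial>replicate_pmf n (geometric_pmf (1 - lam)))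
    = (\<integral>\<^sup>+x. ennreal (F x) \<partial>replicate_pmf n (geometric_pmf (1 - lam)))"
proof -
  let ?P = "replicate_pmf n (geometric_pmf (1 - lam))"
  let ?K = "\<lambda>k::nat. map_pmf (\<lambda>b. if b then k + 1 else k - 1) (bernoulli_pmf (lam / (1 + lam)))"
  have p: "lam / (1 + lam) \<in> {0..1}" "1 - lam / (1 + lam) = 1 / (1 + lam)"
    using lam by (auto simp: field_simps)
  have "(\<integral>\<^sup>+x. ennreal (F x) \<partial>?P)
      = (\<integral>\<^sup>+x. ennreal (F x) \<partial>bind_pmf ?P (\<lambda>x. map_pmf (\<lambda>k. x[j := k]) (?K (x ! j))))"
    using bind_replicate_pmf_site[OF bind_geometric_birth_death[OF lam] j] by simp
  also have "\<dots> = (\<integral>\<^sup>+x. ennreal (site_step lam F x j) \<partial>?P)"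
  proof -
    have "(\<integral>\<^sup>+b. ennreal (F (x[j := if b then x ! j + 1 else x ! j - 1])) \<partial>bernoulli_pmf (lam / (1 + lam)))
        = ennreal (site_step lam F x j)" for x
      using p lam F
      by (simp add: site_step_def bump_def depart_def add_divide_distrib ennreal_plus flip: ennreal_mult')
    then show ?thesis by (simp add: comp_def)
  qed
  finally show ?thesis by simp
qed

lemma site_step_nonneg: "0 < lam \<Longrightarrow> (\<And>x. 0 \<le> F x) \<Longrightarrow> 0 \<le> site_step lam F x k"
  by (simp add: site_step_def)

lemma uniform_op_nonneg: "0 < lam \<Longrightarrow> (\<And>x. 0 \<le> F x) \<Longrightarrow> 0 \<le> uniform_op n lam F x"
  unfolding uniform_op_def by (intro divide_nonneg_nonneg sum_nonneg site_step_nonneg) auto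

lemma uniform_op_pow_nonneg: "0 < lam \<Longrightarrow> (\<And>x. 0 \<le> F x) \<Longrightarrow> 0 \<le> (uniform_op n lam ^^ t) F x"
  by (induction t arbitrary: x) (auto intro: uniform_op_nonneg)

lemma nn_integral_uniform_op:
  assumes lam: "0 < lam" "lam < 1" and F: "\<And>x. 0 \<le> F x" and n: "0 < n"
  shows "(\<integral>\<^sup>+x. ennreal (uniform_op n lam F x) \<partial>replicate_pmf n (geometric_pmf (1 - lam)))
    = (\<integral>\<^sup>+x. ennreal (F x) \<partial>replicate_pmf n (geometric_pmf (1 - lam)))" (is "_ = ?I")
proof -
  have "ennreal (uniform_op n lam F x) = ennreal (1 / real n) * (\<Sum>k<n. ennreal (site_step lam F x k))" for x
    using site_step_nonneg[OF lam(1) F] n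
    by (simp add: uniform_op_def sum_ennreal sum_nonneg flip: ennreal_mult')
  then have "(\<integral>\<^sup>+x. ennreal (uniform_op n lam F x) \<partial>replicate_pmf n (geometric_pmf (1 - lam)))
      = ennreal (1 / real n) * (\<Sum>k<n. \<integral>\<^sup>+x. ennreal (site_step lam F x k) \<partial>replicate_pmf n (geometric_pmf (1 - lam)))"
    by (simp add: nn_integral_cmult nn_integral_sum)
  also have "\<dots> = ennreal (1 / real n) * (of_nat n * ?I)"
    using nn_integral_site_step[OF lam F] by simp
  also have "\<dots> = (ennreal (1 / real n) * ennreal (real n)) * ?I"
    by (simp only: ennreal_of_nat_eq_real_of_nat mult.assoc)
  also have "\<dots> = ?I" using n by (simp flip: ennreal_mult')
  finally show ?thesis .
qed

lemma nn_integral_uniform_op_pow: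
  assumes lam: "0 < lam" "lam < 1" and F: "\<And>x. 0 \<le> F x" and n: "0 < n"
  shows "(\<integral>\<^sup>+x. ennreal ((uniform_op n lam ^^ t) F x) \<partial>replicate_pmf n (geometric_pmf (1 - lam)))
    = (\<integral>\<^sup>+x. ennreal (F x) \<partial>replicate_pmf n (geometric_pmf (1 - lam)))"
  by (induction t) (simp_all add: nn_integral_uniform_op[OF lam uniform_op_pow_nonneg[OF lam(1) F] n])

text \<open>A \<open>schur_increasing\<close> function is smallest at the empty state, so its value
  there is at most its stationary mean, and this mean does not change with time.\<close>

lemma uniform_op_pow_empty_le:
  assumes lam: "0 < lam" "lam < 1" and n: "2 \<le> n" and A: "schur_increasing n (indicator A)"
  shows "ennreal ((uniform_op n lam ^^ t) (indicator A) (replicate n 0))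
    \<le> emeasure (measure_pmf (replicate_pmf n (geometric_pmf (1 - lam)))) A" (is "_ \<le> emeasure (measure_pmf ?P) A")
proof -
  let ?F = "(uniform_op n lam ^^ t) (indicator A)"
  have "ennreal (?F (replicate n 0)) = (\<integral>\<^sup>+x. ennreal (?F (replicate n 0)) \<partial>?P)" by simp
  also have "\<dots> \<le> (\<integral>\<^sup>+x. ennreal (?F x) \<partial>?P)"
  proof (intro nn_integral_mono_AE)
    have "?F (replicate n 0) \<le> ?F x" if "x \<in> set_pmf ?P" for x
      using that schur_increasing_uniform_op_pow[OF lam(1) A] n
      by (intro schur_increasing_zero_le) (auto simp: set_replicate_pmf)
    then show "AE x in ?P. ennreal (?F (replicate n 0)) \<le> ennreal (?F x)"
      by (auto simp: AE_measure_pmf_iff intro: ennreal_leI)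
  qed
  also have "\<dots> = (\<integral>\<^sup>+x. ennreal (indicator A x) \<partial>?P)"
    using n by (intro nn_integral_uniform_op_pow lam) auto
  also have "\<dots> = emeasure (measure_pmf ?P) A" by (simp add: ennreal_indicator)
  finally show ?thesis .
qed

text \<open>With ratio s^2, the tilt (1 / s)^k leaves a geometric series of ratio s. Tilting by the
  square root keeps the exponential moment below 2.\<close>

lemma nn_integral_geometric_power:
  assumes "0 < s" "s < 1"
  shows "(\<integral>\<^sup>+k. ennreal ((1 / s) ^ k) \<partial>geometric_pmf (1 - s\<^sup>2)) = ennreal (1 + s)"
proof -
  have s2: "0 < s\<^sup>2" "s\<^sup>2 < 1" using assms by (auto simp: power_less_one_iff)
  have "(\<integral>\<^sup>+k. ennreal ((1 / s) ^ k) \<partial>geometric_pmf (1 - s\<^sup>2))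
      = (\<Sum>k. ennreal ((1 - s\<^sup>2) * s ^ k))"
  proof -
    have "ennreal (pmf (geometric_pmf (1 - s\<^sup>2)) k) * ennreal ((1 / s) ^ k) = ennreal ((1 - s\<^sup>2) * s ^ k)" for k
      using assms s2
      by (simp add: power_divide power2_eq_square power_mult_distrib flip: ennreal_mult')
    then show ?thesis
      by (simp add: nn_integral_measure_pmf nn_integral_count_space_nat)
  qed
  also have "\<dots> = ennreal ((1 - s\<^sup>2) * (1 / (1 - s)))"
    using assms s2 by (intro suminf_ennreal_eq sums_mult geometric_sums) auto
  also have "(1 - s\<^sup>2) * (1 / (1 - s)) = 1 + s"
    using assms by (simp add: field_simps power2_eq_square)
  finally show ?thesis .
qed

section \<open>Tail of the sum of squares in equilibrium\<close>

lemma sumsq_eq_sum_list: "sumsq x = sum_list (map (\<lambda>k. (real k)\<^sup>2) x)"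
  by (simp add: sumsq_def sum_list_sum_nth atLeast0LessThan)

lemma prod_list_ennreal_exp:
  "prod_list (map (\<lambda>k. ennreal (exp (a k))) x) = ennreal (exp (sum_list (map a x)))"
  by (induction x) (simp_all add: exp_add ennreal_mult')

lemma prod_list_mono_ennreal:
  fixes f g :: "'a \<Rightarrow> ennreal"
  shows "(\<And>k. k \<in> set x \<Longrightarrow> f k \<le> g k) \<Longrightarrow> prod_list (map f x) \<le> prod_list (map g x)"
  by (induction x) (auto intro!: mult_mono)

lemma sum_list_indicator_ge_1:
  "k \<in> set x \<Longrightarrow> k \<in> A \<Longrightarrow> (1::ennreal) \<le> sum_list (map (indicator A) x)"
  by (induction x) (auto simp: add_increasing add_increasing2)

lemma exp_le_one_plus: "exp z \<le> 1 + z * exp z" for z :: real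
proof -
  have "1 - z \<le> exp (- z)" using exp_ge_add_one_self[of "- z"] by simp
  then have "(1 - z) * exp z \<le> exp (- z) * exp z" by (intro mult_right_mono) auto
  then show ?thesis by (simp add: algebra_simps flip: exp_add)
qed

text \<open>The square of a geometric variable has no exponential moment, so lengths are cut at q =
  sqrt n. A union bound handles queues longer than q. Below q, the tilt \<eta> = \<theta> / q
  satisfies \<eta> * k^2 \<le> \<theta> * k, and a Chernoff bound applies. The part 4 / \<theta>^2
  of the constant cancels the moment factor exp (4 * \<eta> / \<theta>^2) of each queue; the extra 1
  leaves exp (- \<eta> * n) = exp (- \<theta> * q).\<close>

lemma geometric_sumsq_tail:
  assumes s: "0 < s" "s < 1" and n: "0 < n" and \<theta>: "\<theta> = - ln s / 2"
  shows "emeasure (measure_pmf (replicate_pmf n (geometric_pmf (1 - s\<^sup>2))))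
           {x. (4 / \<theta>\<^sup>2 + 1) * real n < sumsq x}
         \<le> ennreal ((2 * real n + 1) * exp (- \<theta> * sqrt (real n)))" (is "emeasure (measure_pmf ?P) ?A \<le> _")
proof -
  define q where "q = sqrt (real n)"
  define \<eta> where "\<eta> = \<theta> / q"
  define C where "C = 4 / \<theta>\<^sup>2 + 1"
  have q: "q > 0" "q * q = real n" using n by (auto simp: q_def)
  have \<theta>0: "\<theta> > 0" using s by (simp add: \<theta>)
  have \<eta>: "\<eta> > 0" "\<eta> * q = \<theta>" using \<theta>0 q by (auto simp: \<eta>_def)
  have \<eta>n: "\<eta> * real n = \<theta> * q" using \<eta>(2) q(2) by (metis mult.assoc)
  let ?G = "geometric_pmf (1 - s\<^sup>2)"
  have pow: "(1 / s) ^ k = exp (2 * \<theta> * real k)" for k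
  proof -
    have "1 / s = exp (2 * \<theta>)" using s by (simp add: \<theta> exp_minus inverse_eq_divide)
    then show ?thesis by (simp add: exp_of_nat2_mult)
  qed
  have moment: "(\<integral>\<^sup>+k. ennreal (exp (2 * \<theta> * real k)) \<partial>?G) \<le> ennreal 2"
    unfolding pow[symmetric] nn_integral_geometric_power[OF s] using s by (intro ennreal_leI) simp
  \<comment> \<open>It dominates exp (\<eta> * k^2) only for k \<le> q but has finite mean over all
    k, so the expectation factorises over the queues without truncation.\<close>
  define h where "h k = ennreal (1 + \<eta> * (2 / \<theta>\<^sup>2) * exp (2 * \<theta> * real k))" for k :: nat
  have h: "ennreal (exp (\<eta> * (real k)\<^sup>2)) \<le> h k" if "real k \<le> q" for k
  proof -
    have "\<eta> * (real k)\<^sup>2 \<le> \<eta> * (q * real k)"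
      using that \<eta> by (intro mult_left_mono) (auto simp: power2_eq_square mult_right_mono)
    also have "\<dots> = \<theta> * real k" using \<eta>(2) by (simp flip: mult.assoc)
    finally have le: "\<eta> * (real k)\<^sup>2 \<le> \<theta> * real k" .
    have "(\<theta> * real k)\<^sup>2 / 2 \<le> exp (\<theta> * real k)"
    proof -
      have "0 \<le> \<theta> * real k" using \<theta>0 by simp
      then show ?thesis using exp_lower_Taylor_quadratic[of "\<theta> * real k"] by linarith
    qed
    then have k2: "(real k)\<^sup>2 \<le> 2 / \<theta>\<^sup>2 * exp (\<theta> * real k)"
      using \<theta>0 by (simp add: power_mult_distrib field_simps)
    have "exp (\<eta> * (real k)\<^sup>2) \<le> 1 + (\<eta> * (real k)\<^sup>2) * exp (\<eta> * (real k)\<^sup>2)"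
      by (rule exp_le_one_plus)
    also have "\<dots> \<le> 1 + (\<eta> * (2 / \<theta>\<^sup>2 * exp (\<theta> * real k))) * exp (\<theta> * real k)"
      using le k2 \<eta>(1) by (intro add_left_mono mult_mono mult_left_mono) auto
    also have "\<dots> = 1 + \<eta> * (2 / \<theta>\<^sup>2) * exp (2 * \<theta> * real k)"
      by (simp add: mult.assoc flip: exp_add)
    finally show ?thesis unfolding h_def by (rule ennreal_leI)
  qed
  have int_h: "(\<integral>\<^sup>+k. h k \<partial>?G) \<le> ennreal (exp (4 * \<eta> / \<theta>\<^sup>2))"
  proof -
    have hk: "h k = 1 + ennreal (\<eta> * (2 / \<theta>\<^sup>2)) * ennreal (exp (2 * \<theta> * real k))" for k
      using \<eta> \<theta>0 by (simp add: h_def ennreal_plus flip: ennreal_mult' ennreal_1)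
    have "(\<integral>\<^sup>+k. h k \<partial>?G) = 1 + ennreal (\<eta> * (2 / \<theta>\<^sup>2)) * (\<integral>\<^sup>+k. ennreal (exp (2 * \<theta> * real k)) \<partial>?G)"
      unfolding hk by (simp add: nn_integral_add nn_integral_cmult)
    also have "\<dots> \<le> 1 + ennreal (\<eta> * (2 / \<theta>\<^sup>2)) * ennreal 2"
      using moment by (intro add_left_mono mult_left_mono) auto
    also have "\<dots> = ennreal (1 + 4 * \<eta> / \<theta>\<^sup>2)"
    proof -
      have "ennreal (\<eta> * (2 / \<theta>\<^sup>2)) * ennreal 2 = ennreal (\<eta> * (2 / \<theta>\<^sup>2) * 2)"
        using \<eta> by (subst ennreal_mult) auto
      also have "\<eta> * (2 / \<theta>\<^sup>2) * 2 = 4 * \<eta> / \<theta>\<^sup>2" by simp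
      finally show ?thesis using \<eta> by (simp add: ennreal_plus)
    qed
    also have "\<dots> \<le> ennreal (exp (4 * \<eta> / \<theta>\<^sup>2))" by (intro ennreal_leI exp_ge_add_one_self)
    finally show ?thesis .
  qed
  have big: "emeasure (measure_pmf ?G) {k. q < real k} \<le> ennreal (2 * exp (- \<theta> * q))"
  proof -
    have "emeasure (measure_pmf ?G) {k. q < real k} = (\<integral>\<^sup>+k. indicator {k. q < real k} k \<partial>?G)" by simp
    also have "\<dots> \<le> (\<integral>\<^sup>+k. ennreal (exp (- \<theta> * q)) * ennreal (exp (2 * \<theta> * real k)) \<partial>?G)"
    proof (intro nn_integral_mono)
      fix k
      have "1 \<le> exp (- \<theta> * q) * exp (2 * \<theta> * real k)" if "q < real k"
      proof -
        have "\<theta> * q \<le> \<theta> * real k" "0 \<le> \<theta> * real k" using that \<theta>0 by auto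
        then have "0 \<le> - \<theta> * q + 2 * \<theta> * real k" by simp
        then show ?thesis unfolding exp_add[symmetric] by (simp only: one_le_exp_iff)
      qed
      then show "indicator {k. q < real k} k \<le> ennreal (exp (- \<theta> * q)) * ennreal (exp (2 * \<theta> * real k))"
        by (auto simp: indicator_def simp flip: ennreal_mult')
    qed
    also have "\<dots> = ennreal (exp (- \<theta> * q)) * (\<integral>\<^sup>+k. ennreal (exp (2 * \<theta> * real k)) \<partial>?G)"
      by (simp add: nn_integral_cmult)
    also have "\<dots> \<le> ennreal (exp (- \<theta> * q)) * ennreal 2"
      by (intro mult_left_mono moment) auto
    also have "\<dots> = ennreal (2 * exp (- \<theta> * q))"
      by (subst ennreal_mult[symmetric]) (auto simp: mult.commute)
    finally show ?thesis .
  qed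
  have "emeasure (measure_pmf ?P) ?A = (\<integral>\<^sup>+x. indicator ?A x \<partial>?P)" by simp
  also have "\<dots> \<le> (\<integral>\<^sup>+x. sum_list (map (indicator {k. q < real k}) x)
      + ennreal (exp (- \<eta> * C * real n)) * prod_list (map h x) \<partial>?P)"
  proof (intro nn_integral_mono)
    fix x :: "nat list"
    show "indicator ?A x \<le> sum_list (map (indicator {k. q < real k}) x)
        + ennreal (exp (- \<eta> * C * real n)) * prod_list (map h x)"
    proof (cases "x \<in> ?A")
      case A: True
      show ?thesis
      proof (cases "\<exists>k\<in>set x. q < real k")
        case True
        then have "(1::ennreal) \<le> sum_list (map (indicator {k. q < real k}) x)"
          using sum_list_indicator_ge_1[of _ x "{k. q < real k}"] by blast
        then show ?thesis using A by (simp add: add_increasing2)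
      next
        case False
        have "C * real n \<le> sumsq x" using A by (simp add: C_def)
        then have "\<eta> * (C * real n) \<le> \<eta> * sumsq x" using \<eta> by (intro mult_left_mono) auto
        then have "1 \<le> exp (- \<eta> * C * real n) * exp (\<eta> * sumsq x)"
          unfolding exp_add[symmetric] one_le_exp_iff by simp
        then have "1 \<le> ennreal (exp (- \<eta> * C * real n)) * ennreal (exp (\<eta> * sumsq x))"
          by (simp flip: ennreal_mult')
        also have "ennreal (exp (\<eta> * sumsq x)) = prod_list (map (\<lambda>k. ennreal (exp (\<eta> * (real k)\<^sup>2))) x)"
          by (simp add: prod_list_ennreal_exp sumsq_eq_sum_list sum_list_const_mult)
        also have "\<dots> \<le> prod_list (map h x)"
          by (rule prod_list_mono_ennreal, rule h) (use False in \<open>auto simp: not_less\<close>)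
        finally have "1 \<le> ennreal (exp (- \<eta> * C * real n)) * prod_list (map h x)"
          by (simp add: mult_left_mono)
        then show ?thesis using A by (simp add: add_increasing)
      qed
    qed simp
  qed
  also have "\<dots> = of_nat n * emeasure (measure_pmf ?G) {k. q < real k}
      + ennreal (exp (- \<eta> * C * real n)) * (\<integral>\<^sup>+k. h k \<partial>?G) ^ n"
    by (simp add: nn_integral_add nn_integral_cmult nn_integral_replicate_pmf_sum
        nn_integral_replicate_pmf_prod)
  also have "\<dots> \<le> ennreal (real n) * ennreal (2 * exp (- \<theta> * q))
      + ennreal (exp (- \<eta> * C * real n)) * ennreal (exp (4 * \<eta> / \<theta>\<^sup>2)) ^ n"
    unfolding ennreal_of_nat_eq_real_of_nat
    using big int_h by (intro add_mono mult_left_mono power_mono) auto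
  also have "\<dots> = ennreal (real n * (2 * exp (- \<theta> * q)) + exp (- \<eta> * C * real n) * exp (4 * \<eta> / \<theta>\<^sup>2) ^ n)"
    by (simp add: ennreal_power flip: ennreal_mult' ennreal_plus)
  also have "exp (- \<eta> * C * real n) * exp (4 * \<eta> / \<theta>\<^sup>2) ^ n = exp (- (\<eta> * real n))"
    by (simp add: C_def algebra_simps flip: exp_add exp_of_nat_mult)
  also have "real n * (2 * exp (- \<theta> * q)) + exp (- (\<eta> * real n)) = (2 * real n + 1) * exp (- \<theta> * q)"
    by (simp add: \<eta>n algebra_simps)
  finally show ?thesis by (simp add: q_def C_def)
qed

context supermarket
begin

text \<open>Comparison with the stationary law makes the bound uniform in \<open>t\<close>. With s =
  sqrt lam, the rate - ln s / 2 becomes - ln lam / 4.\<close>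

lemma crowded_tail:
  assumes lam: "lam < 1" and n: "n \<ge> 2" and \<theta>: "\<theta> = - ln lam / 4"
  shows "(T ^^ t) (indicator (crowded (4 / \<theta>\<^sup>2 + 1))) (replicate n 0)
    \<le> (2 * real n + 1) * exp (- \<theta> * sqrt (real n))"
proof -
  define s where "s = sqrt lam"
  have s: "0 < s" "s < 1" "s\<^sup>2 = lam" using lam lam_pos by (auto simp: s_def)
  have \<theta>s: "\<theta> = - ln s / 2" using lam_pos by (simp add: \<theta> s_def ln_sqrt)
  define A where "A = crowded (4 / \<theta>\<^sup>2 + 1)"
  have A: "A = {x. (4 / \<theta>\<^sup>2 + 1) * real n < sumsq x}" by (simp add: A_def crowded_def)
  have schur: "schur_increasing n (indicator A)"
    unfolding A by (rule schur_increasing_sumsq_indicator)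
  have "ennreal ((T ^^ t) (indicator A) (replicate n 0))
      \<le> ennreal ((uniform_op n lam ^^ t) (indicator A) (replicate n 0))"
    by (intro ennreal_leI Tpow_le_uniform_op_pow[OF schur]) simp
  also have "\<dots> \<le> emeasure (measure_pmf (replicate_pmf n (geometric_pmf (1 - lam)))) A"
    by (rule uniform_op_pow_empty_le[OF lam_pos lam n schur])
  also have "\<dots> \<le> ennreal ((2 * real n + 1) * exp (- \<theta> * sqrt (real n)))"
    using geometric_sumsq_tail[OF s(1,2) n_pos \<theta>s] unfolding s(3) A .
  finally show ?thesis unfolding A_def[symmetric] by (subst (asm) ennreal_le_iff) auto
qed

end

section \<open>Concentration\<close>

text \<open>With y = n + r the summand is n^2 / y^2, and 1 / y^2 \<le> 2 / y - 2 / (y + 1)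
  telescopes; the induction carries the remainder explicitly.\<close>

lemma sum_inverse_square_le:
  assumes "n \<ge> 1"
  shows "(\<Sum>r<t. 1 / (1 + real r / real n)\<^sup>2) \<le> 2 * real n"
proof -
  have "(\<Sum>r<t. 1 / (1 + real r / real n)\<^sup>2) \<le> 2 * real n - 2 * (real n)\<^sup>2 / (real n + real t)"
  proof (induction t)
    case 0
    then show ?case using assms by (simp add: power2_eq_square)
  next
    case (Suc t)
    define y where "y = real n + real t"
    have y: "y \<ge> 1" using assms by (simp add: y_def)
    have "1 / (1 + real t / real n)\<^sup>2 = (real n)\<^sup>2 * (1 / y\<^sup>2)"
      using assms by (simp add: y_def divide_simps power2_eq_square)
    also have "1 / y\<^sup>2 \<le> 2 / (y * (y + 1))"
      using y by (simp add: divide_simps power2_eq_square)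
    also have "2 / (y * (y + 1)) = 2 / y - 2 / (y + 1)"
      using y by (simp add: divide_simps)
    finally have "1 / (1 + real t / real n)\<^sup>2 \<le> (real n)\<^sup>2 * (2 / y - 2 / (y + 1))"
      by (simp add: mult_left_mono)
    then have "1 / (1 + real t / real n)\<^sup>2 \<le> 2 * (real n)\<^sup>2 / y - 2 * (real n)\<^sup>2 / (y + 1)"
      by (simp add: right_diff_distrib mult.commute)
    then show ?case using Suc by (simp add: y_def algebra_simps)
  qed
  also have "\<dots> \<le> 2 * real n" by simp
  finally show ?thesis .
qed

context supermarket
begin

lemma variance_bound:
  assumes d2: "d \<ge> 2" and lam1: "lam \<le> 1"
    and k: "real k ^ 2 \<ge> 4 * real d * C" "k > 0" "C > 0"
    and \<alpha>: "\<alpha> = 1 / (4 * ((real k + 1) * (2 * real d) ^ k + 2))"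
    and g: "bump_lipschitz g" and x: "length x = n" "x \<notin> crowded C"
  shows "T (\<lambda>y. ((T ^^ m) g y - (T ^^ m) g x)\<^sup>2) x
    \<le> real d * ((1 + 4 / \<alpha>)\<^sup>2 * (2 + 2 * C) * (1 / (1 + real m / real n)\<^sup>2) + crowding C m x)"
proof -
  define M where "M = (1 + 4 / \<alpha>)\<^sup>2"
  define R where "R = 1 / (1 + real m / real n)\<^sup>2"
  define \<rho> where "\<rho> = 1 - \<alpha> / real n"
  \<comment> \<open>Without the cap 1 the weight could be exponential in the level, which a bound on
    squares does not control.\<close>
  define v where "v l = min 1 (\<rho> ^ m * level_weight (real d) k l)" for l
  have d1: "real d \<ge> 1" "real d > 0" using d2 by auto
  define H where "H = (real k + 1) * (2 * real d) ^ k + 2"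
  have "H \<ge> 2" by (simp add: H_def)
  then have \<alpha>01: "\<alpha> \<le> 1" "\<alpha> > 0" unfolding \<alpha> H_def[symmetric] by (auto simp: divide_simps)
  then have \<rho>: "0 \<le> \<rho>" using n_pos by (simp add: \<rho>_def divide_simps)
  have "T (\<lambda>y. ((T ^^ m) g y - (T ^^ m) g x)\<^sup>2) x \<le> real d / real n * (\<Sum>j<n. v (x ! j) + crowding C m x)"
  proof (rule T_sq_diff_le[OF x(1) bump_lipschitz_Tpow[OF g] _ _ increasing_crowding crowding_nonneg])
    show "mono v"
      unfolding v_def using \<rho> monoD[OF level_weight_mono[OF d1(2), of k]]
      by (intro monoI min.mono mult_left_mono) auto
    show "0 \<le> v l" for l
      unfolding v_def using \<rho> level_weight_ge_1[OF d1(2), of k l] by simp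
    show "\<bar>(T ^^ m) g (bump z i) - (T ^^ m) g z\<bar> \<le> v (z ! i) + crowding C m z"
      if z: "length z = n" "i < n" for z i
    proof -
      have "\<bar>(T ^^ m) g (bump z i) - (T ^^ m) g z\<bar> \<le> 1"
        using bump_lipschitz_Tpow[OF g, of m] z by (simp add: bump_lipschitz_def)
      moreover have "\<bar>(T ^^ m) g (bump z i) - (T ^^ m) g z\<bar>
          \<le> \<rho> ^ m * level_weight (real d) k (z ! i) + crowding C m z"
        unfolding \<rho>_def by (rule influence_decay[OF d2 lam1 k \<alpha> g z])
      ultimately show ?thesis using crowding_nonneg[of C m z] by (simp add: v_def min_def)
    qed
  qed
  also have "\<dots> \<le> real d / real n * (\<Sum>j<n. M * (1 + real (x ! j))\<^sup>2 * R + crowding C m x)"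
  proof (intro mult_left_mono sum_mono add_right_mono)
    fix j
    have "\<rho> \<le> exp (- (\<alpha> / real n))"
      using exp_ge_add_one_self[of "- (\<alpha> / real n)"] by (simp add: \<rho>_def)
    then have "\<rho> ^ m \<le> exp (- (\<alpha> / real n)) ^ m" using \<rho> by (intro power_mono)
    also have "\<dots> = exp (- \<alpha> * (real m / real n))" by (simp flip: exp_of_nat_mult)
    finally have "\<rho> ^ m * level_weight (real d) k (x ! j) \<le> exp (- \<alpha> * (real m / real n)) * (2 * 2 ^ (x ! j))"
      using level_weight_le[OF d1(1), of k "x ! j"] level_weight_ge_1[OF d1(2), of k "x ! j"] \<rho>
      by (intro mult_mono) auto
    then have "v (x ! j) \<le> min 1 (exp (- \<alpha> * (real m / real n)) * (2 * 2 ^ (x ! j)))"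
      unfolding v_def by (intro min.mono) auto
    also have "\<dots> \<le> M * (1 + real (x ! j))\<^sup>2 * R"
      using exponential_weight_le_polynomial[of \<alpha> "real m / real n" "x ! j"] \<alpha>01
      by (simp add: M_def R_def)
    finally show "v (x ! j) \<le> M * (1 + real (x ! j))\<^sup>2 * R" .
  qed simp
  also have "\<dots> = real d / real n * (M * R * (\<Sum>j<n. (1 + real (x ! j))\<^sup>2) + real n * crowding C m x)"
    by (simp add: sum.distrib sum_distrib_left mult_ac)
  also have "\<dots> \<le> real d / real n * (M * R * ((2 + 2 * C) * real n) + real n * crowding C m x)"
  proof (intro mult_left_mono add_right_mono)
    have "(\<Sum>j<n. (1 + real (x ! j))\<^sup>2) \<le> (\<Sum>j<n. 2 + 2 * (real (x ! j))\<^sup>2)"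
    proof (rule sum_mono)
      fix j
      show "(1 + real (x ! j))\<^sup>2 \<le> 2 + 2 * (real (x ! j))\<^sup>2"
        using zero_le_power2[of "1 - real (x ! j)"] by (simp add: power2_eq_square algebra_simps)
    qed
    also have "\<dots> = 2 * real n + 2 * sumsq x"
      using x by (simp add: sum.distrib sumsq_def sum_distrib_left)
    also have "\<dots> \<le> (2 + 2 * C) * real n" using x(2) by (simp add: crowded_def algebra_simps)
    finally show "(\<Sum>j<n. (1 + real (x ! j))\<^sup>2) \<le> (2 + 2 * C) * real n" .
  qed (auto simp: M_def R_def)
  also have "\<dots> = real d * (M * (2 + 2 * C) * R + crowding C m x)"
    using n_pos by (simp add: field_simps)
  finally show ?thesis by (simp add: M_def R_def)
qed

text \<open>Markov's inequality for the expected \<open>crowding\<close> after i steps, a sum of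
  \<open>t\<close> probabilities each at most \<tau>. At the threshold n / t, the allowance for
  crowding adds only a multiple of n to the variance summed over \<open>t\<close> steps.\<close>

lemma bad_probability:
  assumes \<tau>: "\<And>s. (T ^^ s) (indicator (crowded C)) x \<le> \<tau>" and t: "t > 0"
  shows "(T ^^ i) (indicator (crowded C \<union> {y. real n / real t < crowding C t y})) x \<le> \<tau> + (real t)\<^sup>2 * \<tau>"
proof -
  have "(T ^^ i) (indicator (crowded C \<union> {y. real n / real t < crowding C t y})) x
      \<le> (T ^^ i) (\<lambda>y. indicator (crowded C) y + real t / real n * crowding C t y) x"
  proof (rule Tpow_mono)
    fix y
    have "1 \<le> real t / real n * crowding C t y" if "real n / real t < crowding C t y"
      using that t n_pos by (simp add: field_simps)
    moreover have "0 \<le> real t / real n * crowding C t y" using crowding_nonneg by simp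
    ultimately show "indicator (crowded C \<union> {y. real n / real t < crowding C t y}) y
        \<le> indicator (crowded C) y + real t / real n * crowding C t y"
      by (auto simp: indicator_def)
  qed
  also have "\<dots> = (T ^^ i) (indicator (crowded C)) x
      + real t / real n * (\<Sum>r<t. (T ^^ (i + r)) (indicator (crowded C)) x)"
    unfolding Tpow_add Tpow_cmult crowding_def[abs_def] Tpow_sum by (simp add: funpow_add)
  also have "\<dots> \<le> \<tau> + real t / real n * (\<Sum>r<t. \<tau>)"
    by (intro add_mono mult_left_mono sum_mono \<tau>) auto
  also have "\<dots> \<le> \<tau> + (real t)\<^sup>2 * \<tau>"
  proof -
    have "0 \<le> (T ^^ 0) (indicator (crowded C)) x" by simp
    then have "0 \<le> \<tau>" using \<tau>[of 0] by linarith
    then have "(real t)\<^sup>2 * \<tau> / real n \<le> (real t)\<^sup>2 * \<tau>"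
      using n_pos mult_left_mono[of 1 "real n" "(real t)\<^sup>2 * \<tau>"] by (simp add: divide_le_eq)
    then show ?thesis by (simp add: power2_eq_square)
  qed
  finally show ?thesis .
qed

text \<open>The factor 4 * t^3 collects the two tails, the \<open>t\<close> times at which the chain
  may be in the bad set, and the bound \<tau> + t^2 * \<tau> for each of them.\<close>

lemma concentration_from_empty:
  assumes d2: "d \<ge> 2" and lam: "lam < 1" and n2: "n \<ge> 2"
    and \<theta>: "\<theta> = - ln lam / 4" and C: "C = 4 / \<theta>\<^sup>2 + 1"
    and k: "real k ^ 2 \<ge> 4 * real d * C" "k > 0"
    and \<alpha>: "\<alpha> = 1 / (4 * ((real k + 1) * (2 * real d) ^ k + 2))"
    and W: "W = real d * (4 * (1 + 4 / \<alpha>)\<^sup>2 * (1 + C) + 1)"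
    and f: "bump_lipschitz f" and t: "t > 0" and u: "u > 0"
  shows "(T ^^ t) (indicator {y. \<bar>f y - (T ^^ t) f (replicate n 0)\<bar> \<ge> u}) (replicate n 0)
    \<le> 2 * exp (- u\<^sup>2 / (4 * (W * real n + u)))
      + 4 * real t ^ 3 * ((2 * real n + 1) * exp (- \<theta> * sqrt (real n)))"
proof -
  define \<tau> where "\<tau> = (2 * real n + 1) * exp (- \<theta> * sqrt (real n))"
  define Bad where "Bad = crowded C \<union> {y. real n / real t < crowding C t y}"
  define M where "M = (1 + 4 / \<alpha>)\<^sup>2"
  define V where "V r = real d * (M * (2 + 2 * C) * (1 / (1 + real r / real n)\<^sup>2) + real n / real t)" for r
  have C0: "C > 0" unfolding C by (simp add: add_nonneg_pos)
  have \<tau>: "(T ^^ s) (indicator (crowded C)) (replicate n 0) \<le> \<tau>" for s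
    unfolding \<tau>_def C by (rule crowded_tail[OF lam n2 \<theta>])
  have \<tau>0: "\<tau> \<ge> 0" by (simp add: \<tau>_def)
  have "(T ^^ t) (indicator {y. \<bar>f y - (T ^^ t) f (replicate n 0)\<bar> \<ge> u}) (replicate n 0)
    \<le> 2 * exp (- u\<^sup>2 / (4 * (W * real n + u))) + 2 * (\<Sum>i<t. (T ^^ i) (indicator Bad) (replicate n 0))"
  proof (rule Tpow_concentration[OF f _ u, of _ Bad t V])
    show "T (\<lambda>y. ((T ^^ r) g y - (T ^^ r) g x)\<^sup>2) x \<le> V r"
      if g: "bump_lipschitz g" and x: "length x = n" "x \<notin> Bad" and r: "r < t" for g x r
    proof -
      have "T (\<lambda>y. ((T ^^ r) g y - (T ^^ r) g x)\<^sup>2) x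
          \<le> real d * (M * (2 + 2 * C) * (1 / (1 + real r / real n)\<^sup>2) + crowding C r x)"
        unfolding M_def using lam x by (intro variance_bound[OF d2 _ k C0 \<alpha> g]) (auto simp: Bad_def)
      also have "\<dots> \<le> V r"
        unfolding V_def using crowding_mono_time[of r t C x] x r
        by (intro mult_left_mono add_left_mono) (auto simp: Bad_def)
      finally show ?thesis .
    qed
    have "(\<Sum>i<t. V i) = real d * (M * (2 + 2 * C) * (\<Sum>i<t. 1 / (1 + real i / real n)\<^sup>2) + real n)"
      unfolding V_def using t
      by (simp only: sum_distrib_left[symmetric] sum.distrib) (simp add: sum_distrib_left)
    also have "\<dots> \<le> real d * (M * (2 + 2 * C) * (2 * real n) + real n)"
      using sum_inverse_square_le[of n t] n2 C0
      by (intro mult_left_mono add_right_mono) (auto simp: M_def)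
    \<comment> \<open>The time sum 2 * n turns 2 + 2 * C into 4 * (1 + C); the final 1 in
      \<open>W\<close> is the allowance for crowding.\<close>
    also have "\<dots> = W * real n" by (simp add: W M_def algebra_simps)
    finally show "(\<Sum>i<t. V i) \<le> W * real n" .
    show "0 \<le> W * real n" using C0 by (simp add: W)
  qed simp
  also have "(\<Sum>i<t. (T ^^ i) (indicator Bad) (replicate n 0)) \<le> (\<Sum>i<t. \<tau> + (real t)\<^sup>2 * \<tau>)"
    unfolding Bad_def by (intro sum_mono bad_probability[OF \<tau> t])
  also have "\<dots> = real t * \<tau> + real t ^ 3 * \<tau>" by (simp add: power_numeral_reduce algebra_simps)
  also have "\<dots> \<le> real t ^ 3 * \<tau> + real t ^ 3 * \<tau>"
    using t \<tau>0 power_increasing[of 1 3 "real t"] by (intro add_right_mono mult_right_mono) auto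
  finally show ?thesis unfolding \<tau>_def[symmetric] by (simp add: mult_ac)
qed

text \<open>The crude budget of one unit of variance per step, with an empty bad set. It serves the
  finitely many small n, where t is bounded.\<close>

lemma concentration_time_scale:
  assumes f: "bump_lipschitz f" and u: "u > 0"
  shows "(T ^^ t) (indicator {y. \<bar>f y - (T ^^ t) f (replicate n 0)\<bar> \<ge> u}) (replicate n 0)
    \<le> 2 * exp (- u\<^sup>2 / (4 * (real t + u)))"
proof -
  have "(T ^^ t) (indicator {y. \<bar>f y - (T ^^ t) f (replicate n 0)\<bar> \<ge> u}) (replicate n 0)
      \<le> 2 * exp (- u\<^sup>2 / (4 * (real t + u))) + 2 * (\<Sum>i<t. (T ^^ i) (indicator {}) (replicate n 0))"
    by (rule Tpow_concentration[OF f _ u _ , where V = "\<lambda>_. 1"];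
        (rule T_sq_diff_le_1, assumption, erule bump_lipschitz_Tpow)?) simp_all
  also have "indicator {} = (\<lambda>_. 0 :: real)" by auto
  finally show ?thesis by (simp add: Tpow_const)
qed

end

section \<open>Absorption of polynomial factors and choice of the constant\<close>

lemma eventually_stretched_exponential_small:
  fixes \<theta> K :: real
  assumes "\<theta> > 0" "K > 0"
  shows "eventually (\<lambda>n. 4 * (real n powr K) ^ 3 * ((2 * real n + 1) * exp (- \<theta> * sqrt (real n)))
    \<le> exp (- (ln (real n))\<^sup>2)) sequentially"
  using assms by real_asymp

theorem mainTheorem6:
  fixes lam K :: real and d :: nat
  assumes "0 < lam" and "lam < 1" and "d \<ge> 2" and "K > 2"
  shows "\<exists>c::real. c > 0 \<and>
    (\<forall>n::nat. n > 0 \<longrightarrow>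
      (\<forall>f :: nat list \<Rightarrow> real. lipschitz1 n f \<longrightarrow>
        (\<forall>t::nat. 0 < t \<and> real t \<le> real n powr K \<longrightarrow>
          (\<forall>u::real. u > 0 \<longrightarrow>
            (let X = jump_law n lam d (empty_state n) t in
             measure_pmf.prob X {x. \<bar>f x - measure_pmf.expectation X f\<bar> \<ge> u}
               \<le> 2 * exp (- u\<^sup>2 / (4 * c * (real n + u)))
                  + exp (- (ln (real n))\<^sup>2 / c))))))"
proof -
  define \<theta> where "\<theta> = - ln lam / 4"
  define C where "C = 4 / \<theta>\<^sup>2 + 1"
  define k where "k = Suc (nat \<lceil>4 * real d * C\<rceil>)"
  define \<alpha> where "\<alpha> = 1 / (4 * ((real k + 1) * (2 * real d) ^ k + 2))"
  define W where "W = real d * (4 * (1 + 4 / \<alpha>)\<^sup>2 * (1 + C) + 1)"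
  have \<theta>: "\<theta> > 0" using assms by (simp add: \<theta>_def)
  have C: "C > 0" unfolding C_def by (simp add: add_nonneg_pos)
  have W: "W \<ge> 0" using C by (simp add: W_def)
  have k: "real k ^ 2 \<ge> 4 * real d * C" "k > 0"
  proof -
    have "4 * real d * C \<le> real k" unfolding k_def by linarith
    also have "\<dots> \<le> real k ^ 2" by (rule self_le_power) (auto simp: k_def)
    finally show "real k ^ 2 \<ge> 4 * real d * C" .
  qed (simp add: k_def)
  obtain n0 where n0: "\<And>n. n \<ge> n0 \<Longrightarrow>
      4 * (real n powr K) ^ 3 * ((2 * real n + 1) * exp (- \<theta> * sqrt (real n))) \<le> exp (- (ln (real n))\<^sup>2)"
    using eventually_stretched_exponential_small[OF \<theta>, of K] assms
    unfolding eventually_sequentially by auto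
  \<comment> \<open>\<open>W\<close> serves large n. The power bounds t by c * n for n below
    \<open>max n0 2\<close>, a range that includes n = 1, where no pair of queues exists. The
    summand 1 gives c \<ge> 1, used to enlarge both exponentials.\<close>
  define c where "c = W + 1 + real (max n0 2) powr K"
  have c: "c \<ge> 1" "c \<ge> W" "c \<ge> real (max n0 2) powr K" using W by (auto simp: c_def)
  have weaken: "exp (- u\<^sup>2 / (4 * (w + u))) \<le> exp (- u\<^sup>2 / (4 * c * (real n + u)))"
    if "u > 0" "0 \<le> w" "w \<le> c * real n" for u w :: real and n :: nat
  proof -
    have "u \<le> c * u" using mult_right_mono[of 1 c u] c that by simp
    then have "4 * (w + u) \<le> 4 * (c * real n + c * u)"
      using that(3) by (intro mult_left_mono add_mono) auto
    then have "4 * (w + u) \<le> 4 * c * (real n + u)" by (simp only: distrib_left mult.assoc)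
    then have "u\<^sup>2 / (4 * c * (real n + u)) \<le> u\<^sup>2 / (4 * (w + u))"
      using that c by (intro divide_left_mono mult_pos_pos) (auto intro: add_nonneg_pos)
    then show ?thesis by simp
  qed
  show ?thesis
  proof (intro exI[of _ c] conjI allI impI)
    show "c > 0" using c by simp
    fix n :: nat and f t u
    assume n: "n > 0" and f: "lipschitz1 n f" and t: "0 < t \<and> real t \<le> real n powr K" and u: "(u::real) > 0"
    interpret supermarket n lam d using n assms by unfold_locales auto
    have f': "bump_lipschitz f" using f by (rule lipschitz1_imp_bump_lipschitz)
    define Q where "Q = (T ^^ t) (indicator {y. \<bar>f y - (T ^^ t) f (replicate n 0)\<bar> \<ge> u}) (replicate n 0)"
    have "Q \<le> 2 * exp (- u\<^sup>2 / (4 * c * (real n + u))) + exp (- (ln (real n))\<^sup>2 / c)"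
    proof (cases "n \<ge> max n0 2")
      case True
      then have n2: "n \<ge> 2" and nn0: "n \<ge> n0" by auto
      have "Q \<le> 2 * exp (- u\<^sup>2 / (4 * (W * real n + u)))
          + 4 * real t ^ 3 * ((2 * real n + 1) * exp (- \<theta> * sqrt (real n)))"
        unfolding Q_def using t
        by (intro concentration_from_empty[OF assms(3,2) n2 \<theta>_def C_def k \<alpha>_def W_def f' _ u]) auto
      also have "4 * real t ^ 3 * ((2 * real n + 1) * exp (- \<theta> * sqrt (real n)))
          \<le> 4 * (real n powr K) ^ 3 * ((2 * real n + 1) * exp (- \<theta> * sqrt (real n)))"
        using t by (intro mult_right_mono mult_left_mono power_mono) auto
      also have "\<dots> \<le> exp (- (ln (real n))\<^sup>2)" by (rule n0[OF nn0])
      also have "exp (- (ln (real n))\<^sup>2) \<le> exp (- (ln (real n))\<^sup>2 / c)"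
        using c mult_left_mono[of 1 c "(ln (real n))\<^sup>2"] by (simp add: divide_le_eq)
      also have "exp (- u\<^sup>2 / (4 * (W * real n + u))) \<le> exp (- u\<^sup>2 / (4 * c * (real n + u)))"
        by (rule weaken) (use u W c in \<open>auto intro: mult_right_mono\<close>)
      finally show ?thesis by simp
    next
      case False
      have "real t \<le> real n powr K" using t by simp
      also have "\<dots> \<le> real (max n0 2) powr K" using False assms by (intro powr_mono2) auto
      also have "\<dots> \<le> c * 1" using c(3) by simp
      also have "\<dots> \<le> c * real n" using c(1) n by (intro mult_left_mono) auto
      finally have tc: "real t \<le> c * real n" .
      have "Q \<le> 2 * exp (- u\<^sup>2 / (4 * (real t + u)))"
        unfolding Q_def by (rule concentration_time_scale[OF f' u])
      also have "exp (- u\<^sup>2 / (4 * (real t + u))) \<le> exp (- u\<^sup>2 / (4 * c * (real n + u)))"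
        by (rule weaken) (use u tc in auto)
      finally show ?thesis by (simp add: add_increasing2)
    qed
    then show "let X = jump_law n lam d (empty_state n) t in
             measure_pmf.prob X {x. \<bar>f x - measure_pmf.expectation X f\<bar> \<ge> u}
               \<le> 2 * exp (- u\<^sup>2 / (4 * c * (real n + u))) + exp (- (ln (real n))\<^sup>2 / c)"
      by (simp add: Q_def Let_def empty_state_def prob_jump_law[OF n assms(1)] expectation_jump_law[OF n assms(1)])
  qed
qed

end
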